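(* Let $M$ be an arcwise connected, Hausdorff, locally arcwise and simply connected space, and let $M_\prec$ be a base for the topology of $M$ consisting of (nonempty) arcwise and simply connected open subsets, regarded as a poset ordered under inclusion. Then there is an isomorphism $H_1(M,\mathbb{Z})\simeq H_1(M_\prec,\mathbb{Z})$ between the first singular homology of $M$ and the first net homology of $M_\prec$. For every Abelian group $A$ there is an isomorphism $H^1(M_\prec,A)\simeq \mathrm{Hom}(H_1(M,\mathbb{Z}),A)$, and this implies the isomorphism $H^1(M_\prec,A)\simeq H^1(M,A)$, where $H^1(M_\prec,A)$ is net cohomology and $H^1(M,A)$ is singular cohomology.
   Context: Simplices of a poset $K$: a $0$-simplex is an element of $K$. A $1$-simplex $b=(|b|;\partial_0b,\partial_1b)$ consists of elements $|b|$ (the support), $\partial_0b,\partial_1b$ of $K$ with $\partial_0b,\partial_1b\leq|b|$. A $2$-simplex $c$ consists of $1$-simplices $\partial_0c,\partial_1c,\partial_2c$ and a support $|c|\in K$ with $|\partial_ic|\leq|c|$, satisfying $\partial_0\partial_1c=\partial_0\partial_0c$, $\partial_0\partial_2c=\partial_1\partial_0c$, $\partial_1\partial_2c=\partial_1\partial_1c$. The set of $n$-simplices is denoted $\widetilde\Sigma_n(K)$. Net homology: $C_n(K,\mathbb{Z})$ is the free Abelian group on $\widetilde\Sigma_n(K)$; $\mathrm{b}_nx=\sum_{k=0}^n(-1)^k\partial_kx$ extended linearly; $H_1(K,\mathbb{Z})=\ker\mathrm{b}_1/\mathrm{b}_2(C_2(K,\mathbb{Z}))$. Net cohomology with values in an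 Abelian group $A$ (written additively): $C^n(K,A)$ is the group of functions $v:\widetilde\Sigma_n(K)\to A$; the coboundary $\mathrm{d}:C^n(K,A)\to C^{n+1}(K,A)$ is $\mathrm{d}v(x)=\sum_k(-1)^kv(\partial_kx)$; $H^1(K,A)$ is the group of $1$-cocycles ($\ker\mathrm{d}$ on $C^1$) modulo $\mathrm{d}C^0(K,A)$. *)

theory Defs
  imports "HOL-Homology.Homology"
begin

section \<open>Simple connectedness of abstract topological spaces\<close>

text \<open>The library predicate \<^const>\<open>simply_connected\<close> is for subsets of a type of class
  \<^class>\<open>topological_space\<close>. Here \<open>\<pi>\<^sub>1 = 1\<close> is stated for an abstract topology: every loop is
  contractible relative to its base point. As in the library, the empty space is included.\<close>

definition simply_connected_space :: "'a topology \<Rightarrow> bool" where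
  "simply_connected_space X \<longleftrightarrow>
     path_connected_space X \<and>
     (\<forall>g. pathin X g \<and> g 0 = g 1 \<longrightarrow>
        homotopic_with (\<lambda>h. h 0 = g 0 \<and> h 1 = g 0) (top_of_set {0..1}) X g (\<lambda>_. g 0))"

definition simply_connectedin :: "'a topology \<Rightarrow> 'a set \<Rightarrow> bool" where
  "simply_connectedin X S \<longleftrightarrow> S \<subseteq> topspace X \<and> simply_connected_space (subtopology X S)"

definition locally_simply_connected_space :: "'a topology \<Rightarrow> bool" where
  "locally_simply_connected_space X \<longleftrightarrow> neighbourhood_base_of (simply_connectedin X) X"

lemma simply_connected_space_top_of_set:
  fixes S :: "'a::real_normed_vector set"
  shows "simply_connected_space (top_of_set S) \<longleftrightarrow> simply_connected S"
proof -
  have lp: "linepath a a = (\<lambda>_. a)" for a :: 'a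
    by (auto simp: linepath_def algebra_simps)
  have "((continuous_on {0..1} g \<and> g \<in> {0..1} \<rightarrow> S) \<and> g 0 = g 1 \<longrightarrow>
          homotopic_with_canon (\<lambda>h. h 0 = g 0 \<and> h 1 = g 0) {0..1} S g (\<lambda>_. g 0))
      \<longleftrightarrow> (continuous_on {0..1} g \<and> g ` {0..1} \<subseteq> S \<and> g 1 = g 0 \<longrightarrow>
          homotopic_with_canon (\<lambda>h. h 0 = g 0 \<and> h 1 = g 1) {0..1} S g (\<lambda>_. g 0))"
    for g :: "real \<Rightarrow> 'a"
    by (cases "g 1 = g 0") (auto simp: image_subset_iff_funcset)
  then show ?thesis
    unfolding simply_connected_space_def simply_connected_eq_contractible_path
      homotopic_paths_def pathin_canon_iff path_connected_space_euclidean_subtopology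
      lp pathstart_def pathfinish_def path_image_def path_def
    by (simp only:)
qed


section \<open>Homomorphism groups and singular cohomology\<close>

text \<open>Homomorphisms are made \<^const>\<open>extensional\<close> so that distinct elements of the carrier are
  distinct as maps on \<open>carrier G\<close>.\<close>

definition Hom_group ::
    "('a, 'b) monoid_scheme \<Rightarrow> ('c, 'd) monoid_scheme \<Rightarrow> ('a \<Rightarrow> 'c) monoid" where
  "Hom_group G A =
     \<lparr>carrier = hom G A \<inter> extensional (carrier G),
      monoid.mult = (\<lambda>f g. \<lambda>x\<in>carrier G. f x \<otimes>\<^bsub>A\<^esub> g x),
      one = (\<lambda>x\<in>carrier G. \<one>\<^bsub>A\<^esub>)\<rparr>"

abbreviation singular_cochain_group ::
    "nat \<Rightarrow> 'a topology \<Rightarrow> ('c, 'd) monoid_scheme \<Rightarrow> ('a chain \<Rightarrow> 'c) monoid" where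
  "singular_cochain_group p X A \<equiv> Hom_group (chain_group p X) A"

text \<open>Following the indexing of \<^const>\<open>chain_boundary\<close>, \<open>singular_coboundary p\<close> maps
  \<open>(p - 1)\<close>-cochains to \<open>p\<close>-cochains. Since \<open>chain_boundary 0 = 0\<close>, it is trivial for \<open>p = 0\<close>,
  so the quotient below is also right in degree \<open>0\<close>.\<close>

definition singular_coboundary ::
    "nat \<Rightarrow> 'a topology \<Rightarrow> ('a chain \<Rightarrow> 'c) \<Rightarrow> 'a chain \<Rightarrow> 'c" where
  "singular_coboundary p X f = (\<lambda>c\<in>singular_chain_set p X. f (chain_boundary p c))"

definition singular_cohomology_group ::
    "nat \<Rightarrow> 'a topology \<Rightarrow> ('c, 'd) monoid_scheme \<Rightarrow> ('a chain \<Rightarrow> 'c) set monoid" where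
  "singular_cohomology_group p X A =
     subgroup_generated (singular_cochain_group p X A)
       (kernel (singular_cochain_group p X A) (singular_cochain_group (Suc p) X A)
          (singular_coboundary (Suc p) X))
     Mod (singular_coboundary p X ` carrier (singular_cochain_group (p - 1) X A))"


section \<open>Net homology and cohomology of a poset\<close>

text \<open>A poset is a subset \<open>K\<close> of an ordered type; its \<open>0\<close>-simplices are the elements of \<open>K\<close>.
  The selectors \<open>face1_i\<close> and \<open>face2_i\<close> are the face maps \<open>\<partial>\<^sub>i\<close>.\<close>

datatype 'k simplex1 = Simplex1 (supp1: 'k) (face1_0: 'k) (face1_1: 'k)

datatype 'k simplex2 = Simplex2 (supp2: 'k)
  (face2_0: "'k simplex1") (face2_1: "'k simplex1") (face2_2: "'k simplex1")

definition net_simplices1 :: "'k::order set \<Rightarrow> 'k simplex1 set" where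
  "net_simplices1 K =
     {b. supp1 b \<in> K \<and> face1_0 b \<in> K \<and> face1_1 b \<in> K \<and>
         face1_0 b \<le> supp1 b \<and> face1_1 b \<le> supp1 b}"

definition net_simplices2 :: "'k::order set \<Rightarrow> 'k simplex2 set" where
  "net_simplices2 K =
     {c. supp2 c \<in> K \<and>
         face2_0 c \<in> net_simplices1 K \<and> face2_1 c \<in> net_simplices1 K \<and>
         face2_2 c \<in> net_simplices1 K \<and>
         supp1 (face2_0 c) \<le> supp2 c \<and> supp1 (face2_1 c) \<le> supp2 c \<and>
         supp1 (face2_2 c) \<le> supp2 c \<and>
         face1_0 (face2_1 c) = face1_0 (face2_0 c) \<and>
         face1_0 (face2_2 c) = face1_1 (face2_0 c) \<and>
         face1_1 (face2_2 c) = face1_1 (face2_1 c)}"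

definition net_boundary1 :: "('k simplex1 \<Rightarrow>\<^sub>0 int) \<Rightarrow> ('k \<Rightarrow>\<^sub>0 int)" where
  "net_boundary1 = frag_extend (\<lambda>b. frag_of (face1_0 b) - frag_of (face1_1 b))"

definition net_boundary2 :: "('k simplex2 \<Rightarrow>\<^sub>0 int) \<Rightarrow> ('k simplex1 \<Rightarrow>\<^sub>0 int)" where
  "net_boundary2 =
     frag_extend (\<lambda>c. frag_of (face2_0 c) - frag_of (face2_1 c) + frag_of (face2_2 c))"

definition net_homology1 :: "'k::order set \<Rightarrow> ('k simplex1 \<Rightarrow>\<^sub>0 int) set monoid" where
  "net_homology1 K =
     subgroup_generated (free_Abelian_group (net_simplices1 K))
       (kernel (free_Abelian_group (net_simplices1 K)) (free_Abelian_group K) net_boundary1)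
     Mod (net_boundary2 ` carrier (free_Abelian_group (net_simplices2 K)))"

text \<open>The coefficient group is written multiplicatively, following HOL-Algebra.\<close>

definition net_coboundary0 ::
    "'k::order set \<Rightarrow> ('a, 'b) monoid_scheme \<Rightarrow> ('k \<Rightarrow> 'a) \<Rightarrow> 'k simplex1 \<Rightarrow> 'a" where
  "net_coboundary0 K A v =
     (\<lambda>b\<in>net_simplices1 K. v (face1_0 b) \<otimes>\<^bsub>A\<^esub> inv\<^bsub>A\<^esub> v (face1_1 b))"

definition net_coboundary1 ::
    "'k::order set \<Rightarrow> ('a, 'b) monoid_scheme \<Rightarrow> ('k simplex1 \<Rightarrow> 'a) \<Rightarrow> 'k simplex2 \<Rightarrow> 'a" where
  "net_coboundary1 K A v =
     (\<lambda>c\<in>net_simplices2 K. v (face2_0 c) \<otimes>\<^bsub>A\<^esub> inv\<^bsub>A\<^esub> v (face2_1 c) \<otimes>\<^bsub>A\<^esub> v (face2_2 c))"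

definition net_cohomology1 ::
    "'k::order set \<Rightarrow> ('a, 'b) monoid_scheme \<Rightarrow> ('k simplex1 \<Rightarrow> 'a) set monoid" where
  "net_cohomology1 K A =
     subgroup_generated (product_group (net_simplices1 K) (\<lambda>_. A))
       (kernel (product_group (net_simplices1 K) (\<lambda>_. A))
          (product_group (net_simplices2 K) (\<lambda>_. A)) (net_coboundary1 K A))
     Mod (net_coboundary0 K A ` carrier (product_group K (\<lambda>_. A)))"

end

(*
Fix a point x_U in every U of the base. Sending a net 1-simplex b to a path in |b| from the point of
its face 1 to the point of its face 0 is a chain map up to degree 1, and it maps net boundaries to
boundaries because a closed edge path inside a simply connected set bounds. An inverse modulo
boundaries is obtained by subdividing a singular chain until each of its simplices lies in a member of
the base. A small edge from p to q inside V is sent to the edge path U_p <- W_p -> V <- W_q -> U_q,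
where U_p is a fixed member of the base around p and W_p lies in the intersection of V and U_p. Modulo
net boundaries this does not depend on W_p and W_q, and it is unchanged when V is replaced by a smaller
member; since it is therefore locally constant along paths, it does not depend on V either.

In degree 1 the universal coefficient theorem has no Ext term: connectedness provides a homomorphism K
from 0-chains to 1-chains with d K d = d, and id - K d retracts the 1-chains onto the 1-cycles.
*)
theory Submission
  imports Defs
begin

text \<open>The obstacle is that two members of the base may meet in a set that is neither a member
  nor connected. Two members V and V' containing points p and q therefore need not give homologous
  edge paths for p and q; they do here because the small edge itself runs inside both, so that p and
  q lie in one path component of the intersection. This is why the construction starts from
  simplices and not from pairs of points.

  The maps in the two directions are inverse only on homology classes. Each comparison is stated for
  1-chains that need not be cycles, with an error term that factors through the boundary: the
  degree-0 part of a chain homotopy. In this form it can be checked on generators, and on cycles the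
  error term vanishes. Subdivision fits in because it fixes 0-chains and keeps a chain inside any
  set that contains it.

  Simple connectedness of a member enters as path connectedness together with the vanishing of its
  first homology. The latter is derived from contractions of loops, with the interval and the square
  as contractible models in place of explicit 2-chains.\<close>

declare One_nat_def [simp del]

section \<open>Homomorphism groups and quotients\<close>

text \<open>The composite of \<open>f\<close> with the projection onto \<open>H Mod N'\<close> is
  surjective with kernel \<open>N\<close>, and the first isomorphism theorem applies.
  \<open>onto\<close> asks for a preimage only modulo \<open>N'\<close>, since realized net cycles
  reach a singular cycle only up to a boundary.\<close>

lemma FactGroup_iso_FactGroup:
  assumes f: "f \<in> hom G H" and N: "N \<lhd> G" and N': "N' \<lhd> H"
    and ker: "\<And>x. x \<in> carrier G \<Longrightarrow> f x \<in> N' \<longleftrightarrow> x \<in> N"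
    and onto: "\<And>y. y \<in> carrier H \<Longrightarrow> \<exists>x\<in>carrier G. y \<otimes>\<^bsub>H\<^esub> inv\<^bsub>H\<^esub> f x \<in> N'"
  shows "G Mod N \<cong> H Mod N'"
proof -
  interpret N: normal N G by fact
  interpret N': normal N' H by fact
  let ?q = "\<lambda>x. N' #>\<^bsub>H\<^esub> f x"
  have fx: "f x \<in> carrier H" if "x \<in> carrier G" for x
    using f that by (auto simp: hom_def)
  have q: "?q \<in> hom G (H Mod N')"
    using hom_compose [OF f N'.r_coset_hom_Mod] by (simp add: comp_def)
  interpret q: group_hom G "H Mod N'" ?q
    using q N.is_group N'.factorgroup_is_group by (simp add: group_hom_def group_hom_axioms_def)
  have eq1: "?q x = N' \<longleftrightarrow> f x \<in> N'" if "x \<in> carrier G" for x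
    using fx [OF that] N'.subgroup_axioms
    by (metis N'.is_group group.coset_join1 group.coset_join2 N'.rcos_const N'.rcos_self N'.subset)
  have "kernel G (H Mod N') ?q = N"
    using eq1 ker N.subset by (auto simp: kernel_def)
  moreover have "?q ` carrier G = carrier (H Mod N')"
  proof -
    have "\<exists>x\<in>carrier G. N' #>\<^bsub>H\<^esub> y = ?q x" if y: "y \<in> carrier H" for y
    proof -
      obtain x where x: "x \<in> carrier G" "y \<otimes>\<^bsub>H\<^esub> inv\<^bsub>H\<^esub> f x \<in> N'"
        using onto y by blast
      then have "y \<in> N' #>\<^bsub>H\<^esub> f x"
        using N'.rcos_module_rev [OF N'.is_group fx y] by blast
      then show ?thesis
        using x fx N'.repr_independence N'.subgroup_axioms by blast
    qed
    then show ?thesis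
      using fx by (auto simp: carrier_FactGroup image_iff)
  qed
  ultimately show ?thesis
    using q.FactGroup_iso by simp
qed

lemma carrier_Hom_group: "carrier (Hom_group G A) = hom G A \<inter> extensional (carrier G)"
  and mult_Hom_group: "f \<otimes>\<^bsub>Hom_group G A\<^esub> g = (\<lambda>x\<in>carrier G. f x \<otimes>\<^bsub>A\<^esub> g x)"
  and one_Hom_group: "\<one>\<^bsub>Hom_group G A\<^esub> = (\<lambda>x\<in>carrier G. \<one>\<^bsub>A\<^esub>)"
  by (simp_all add: Hom_group_def)

lemma restrict_in_Hom_group:
  assumes "group G" "f \<in> hom G A"
  shows "restrict f (carrier G) \<in> carrier (Hom_group G A)"
  using assms by (auto simp: carrier_Hom_group hom_def Pi_iff group.is_monoid monoid.m_closed)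

lemma comm_group_Hom_group:
  assumes G: "group G" and A: "comm_group A"
  shows "comm_group (Hom_group G A)"
proof -
  interpret G: group G by fact
  interpret A: comm_group A by fact
  show ?thesis
  proof (rule comm_groupI)
    fix f g assume fg: "f \<in> carrier (Hom_group G A)" "g \<in> carrier (Hom_group G A)"
    show "f \<otimes>\<^bsub>Hom_group G A\<^esub> g \<in> carrier (Hom_group G A)"
      using fg A.m_comm A.m_assoc A.m_lcomm
      by (auto simp: carrier_Hom_group mult_Hom_group hom_def Pi_iff)
  next
    show "\<one>\<^bsub>Hom_group G A\<^esub> \<in> carrier (Hom_group G A)"
      by (auto simp: carrier_Hom_group one_Hom_group hom_def)
  next
    fix f g h
    assume "f \<in> carrier (Hom_group G A)" "g \<in> carrier (Hom_group G A)" "h \<in> carrier (Hom_group G A)"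
    then show "f \<otimes>\<^bsub>Hom_group G A\<^esub> g \<otimes>\<^bsub>Hom_group G A\<^esub> h = f \<otimes>\<^bsub>Hom_group G A\<^esub> (g \<otimes>\<^bsub>Hom_group G A\<^esub> h)"
      by (auto simp: carrier_Hom_group mult_Hom_group hom_def Pi_iff A.m_assoc)
  next
    fix f g assume "f \<in> carrier (Hom_group G A)" "g \<in> carrier (Hom_group G A)"
    then show "f \<otimes>\<^bsub>Hom_group G A\<^esub> g = g \<otimes>\<^bsub>Hom_group G A\<^esub> f"
      by (auto simp: carrier_Hom_group mult_Hom_group hom_def Pi_iff A.m_comm)
  next
    fix f assume "f \<in> carrier (Hom_group G A)"
    then show "\<one>\<^bsub>Hom_group G A\<^esub> \<otimes>\<^bsub>Hom_group G A\<^esub> f = f"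
      by (auto simp: carrier_Hom_group mult_Hom_group one_Hom_group hom_def Pi_iff extensional_def)
  next
    fix f assume f: "f \<in> carrier (Hom_group G A)"
    show "\<exists>g\<in>carrier (Hom_group G A). g \<otimes>\<^bsub>Hom_group G A\<^esub> f = \<one>\<^bsub>Hom_group G A\<^esub>"
    proof
      show "(\<lambda>x\<in>carrier G. inv\<^bsub>A\<^esub> f x) \<in> carrier (Hom_group G A)"
        using f by (auto simp: carrier_Hom_group hom_def Pi_iff A.inv_mult)
      show "(\<lambda>x\<in>carrier G. inv\<^bsub>A\<^esub> f x) \<otimes>\<^bsub>Hom_group G A\<^esub> f = \<one>\<^bsub>Hom_group G A\<^esub>"
        using f by (auto simp: carrier_Hom_group mult_Hom_group one_Hom_group hom_def Pi_iff)
    qed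
  qed
qed

lemma Hom_group_cong_iso:
  assumes G: "group G" and G': "group G'" and iso: "G \<cong> G'"
  shows "Hom_group G A \<cong> Hom_group G' A"
proof -
  obtain f g where fg: "group_isomorphisms G G' f g"
    using iso G group.iso_iff_group_isomorphisms by (force simp: is_iso_def)
  then have f: "f \<in> hom G G'" and g: "g \<in> hom G' G"
    and gf: "\<And>x. x \<in> carrier G \<Longrightarrow> g (f x) = x" and fg: "\<And>y. y \<in> carrier G' \<Longrightarrow> f (g y) = y"
    by (auto simp: group_isomorphisms_def)
  have fx: "\<And>x. x \<in> carrier G \<Longrightarrow> f x \<in> carrier G'" and gx: "\<And>x. x \<in> carrier G' \<Longrightarrow> g x \<in> carrier G"
    using f g by (auto simp: hom_def)
  let ?P = "\<lambda>h. \<lambda>y\<in>carrier G'. h (g y)"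
  let ?Q = "\<lambda>h. \<lambda>x\<in>carrier G. h (f x)"
  have P: "?P h \<in> carrier (Hom_group G' A)" if "h \<in> carrier (Hom_group G A)" for h
    using restrict_in_Hom_group [OF G' hom_compose [OF g]] that
    by (auto simp: carrier_Hom_group comp_def)
  have Q: "?Q h \<in> carrier (Hom_group G A)" if "h \<in> carrier (Hom_group G' A)" for h
    using restrict_in_Hom_group [OF G hom_compose [OF f]] that
    by (auto simp: carrier_Hom_group comp_def)
  have "?P \<in> hom (Hom_group G A) (Hom_group G' A)"
    using P gx by (auto simp: hom_def mult_Hom_group)
  moreover have "bij_betw ?P (carrier (Hom_group G A)) (carrier (Hom_group G' A))"
  proof (rule bij_betw_byWitness [where f' = ?Q])
    show "\<forall>h\<in>carrier (Hom_group G A). ?Q (?P h) = h"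
      using fx gf by (auto simp: carrier_Hom_group extensional_def fun_eq_iff)
    show "\<forall>h\<in>carrier (Hom_group G' A). ?P (?Q h) = h"
      using gx fg by (auto simp: carrier_Hom_group extensional_def fun_eq_iff)
  qed (use P Q in auto)
  ultimately show ?thesis
    by (auto simp: is_iso_def iso_def)
qed

text \<open>The universal coefficient theorem in the absence of an \<open>Ext\<close> term: \<open>c \<mapsto> c - K (d c)\<close> retracts
  the chains \<open>C\<close> onto the cycles, so every homomorphism on the cycles extends to \<open>C\<close>.\<close>

lemma Hom_group_homology_iso:
  fixes C :: "('c, 'r) monoid_scheme" and C0 :: "('d, 's) monoid_scheme"
    and A :: "('a, 't) monoid_scheme" and E :: "('e, 'u) monoid_scheme"
  assumes C: "comm_group C" and C0: "group C0" and A: "comm_group A" and E: "comm_group E"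
    and d: "d \<in> hom C C0" and K: "K \<in> hom C0 C"
    and dKd: "\<And>c. c \<in> carrier C \<Longrightarrow> d (K (d c)) = d c"
    and N: "subgroup N C" and NZ: "N \<subseteq> kernel C C0 d"
    and \<theta>: "\<theta> \<in> iso E (Hom_group C A)"
    and Zc: "\<And>e. e \<in> carrier E \<Longrightarrow> e \<in> Zc \<longleftrightarrow> (\<forall>n\<in>N. \<theta> e n = \<one>\<^bsub>A\<^esub>)" and ZcE: "Zc \<subseteq> carrier E"
    and Bc: "\<And>e. e \<in> carrier E \<Longrightarrow> e \<in> Bc \<longleftrightarrow> (\<exists>g\<in>hom C0 A. \<forall>c\<in>carrier C. \<theta> e c = g (d c))"
    and BcE: "Bc \<subseteq> carrier E"
  shows "Hom_group (subgroup_generated C (kernel C C0 d) Mod N) A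
         \<cong> subgroup_generated E Zc Mod Bc"
proof -
  interpret C: comm_group C by fact
  interpret C0: group C0 by fact
  interpret A: comm_group A by fact
  interpret E: comm_group E by fact
  interpret d: group_hom C C0 d
    using d by (simp add: group_hom_def group_hom_axioms_def)
  interpret K: group_hom C0 C K
    using K by (simp add: group_hom_def group_hom_axioms_def)
  define Z where "Z = kernel C C0 d"
  define H where "H = subgroup_generated C Z Mod N"
  have sZ: "subgroup Z C"
    unfolding Z_def by (rule d.subgroup_kernel)
  have cZ [simp]: "carrier (subgroup_generated C Z) = Z"
    using sZ subgroup.carrier_subgroup_generated_subgroup by blast
  interpret CZ: comm_group "subgroup_generated C Z"
    using C C.abelian_subgroup_generated by blast
  have nN: "N \<lhd> subgroup_generated C Z"
    using CZ.normal_iff_subgroup C.subgroup_of_subgroup_generated N NZ Z_def by blast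
  interpret nN: normal N "subgroup_generated C Z" by fact
  have gH: "group H"
    unfolding H_def by (rule nN.factorgroup_is_group)
  have HomA: "comm_group (Hom_group C A)" "comm_group (Hom_group H A)"
    using comm_group_Hom_group C.is_group A gH by auto
  \<comment> \<open>\<open>E\<close> stands for the cochains in whatever form they come: for
    singular cochains \<theta> is the identity, for net cochains it extends a function on simplices
    linearly.\<close>
  interpret \<theta>: group_hom E "Hom_group C A" \<theta>
    using \<theta> HomA comm_group.axioms(2) by (auto simp: group_hom_def group_hom_axioms_def iso_def)
  have \<theta>C: "\<theta> e \<in> hom C A" if "e \<in> carrier E" for e
    using \<theta>.hom_closed [OF that] by (simp add: carrier_Hom_group)
  have \<theta>m: "\<theta> (e \<otimes>\<^bsub>E\<^esub> e') c = \<theta> e c \<otimes>\<^bsub>A\<^esub> \<theta> e' c"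
    if "e \<in> carrier E" "e' \<in> carrier E" "c \<in> carrier C" for e e' c
    using that by (simp add: mult_Hom_group)
  have \<theta>1: "\<theta> \<one>\<^bsub>E\<^esub> c = \<one>\<^bsub>A\<^esub>" if "c \<in> carrier C" for c
    using that by (simp add: one_Hom_group)
  note [simp del] = \<theta>.hom_mult \<theta>.hom_inv \<theta>.hom_one
  have \<theta>i: "\<theta> (inv\<^bsub>E\<^esub> e) c = inv\<^bsub>A\<^esub> \<theta> e c" if e: "e \<in> carrier E" and c: "c \<in> carrier C" for e c
  proof -
    have "\<theta> (inv\<^bsub>E\<^esub> e) c \<otimes>\<^bsub>A\<^esub> \<theta> e c = \<one>\<^bsub>A\<^esub>"
      using \<theta>m [of "inv\<^bsub>E\<^esub> e" e c] e c \<theta>1 by simp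
    then show ?thesis
      using e c \<theta>C [of e] \<theta>C [of "inv\<^bsub>E\<^esub> e"] by (metis A.inv_equality E.inv_closed hom_in_carrier)
  qed
  have NC: "n \<in> carrier C" if "n \<in> N" for n
    using that N subgroup.mem_carrier by metis
  have ZC: "z \<in> carrier C" if "z \<in> Z" for z
    using that sZ subgroup.mem_carrier by metis
  have sZc: "subgroup Zc E"
  proof (rule E.subgroupI)
    have "\<one>\<^bsub>E\<^esub> \<in> Zc"
      using Zc \<theta>1 NC by simp
    then show "Zc \<noteq> {}"
      by blast
    show "inv\<^bsub>E\<^esub> e \<in> Zc" if "e \<in> Zc" for e
    proof -
      have "\<theta> (inv\<^bsub>E\<^esub> e) n = \<one>\<^bsub>A\<^esub>" if "n \<in> N" for n
        using that \<open>e \<in> Zc\<close> \<theta>i [of e n] NC [of n] Zc [of e] ZcE by auto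
      then show ?thesis
        using Zc [of "inv\<^bsub>E\<^esub> e"] that ZcE by auto
    qed
    show "e \<otimes>\<^bsub>E\<^esub> e' \<in> Zc" if "e \<in> Zc" "e' \<in> Zc" for e e'
    proof -
      have "\<theta> (e \<otimes>\<^bsub>E\<^esub> e') n = \<one>\<^bsub>A\<^esub>" if "n \<in> N" for n
        using that \<open>e \<in> Zc\<close> \<open>e' \<in> Zc\<close> \<theta>m [of e e' n] NC [of n] Zc [of e] Zc [of e'] ZcE by auto
      then show ?thesis
        using Zc [of "e \<otimes>\<^bsub>E\<^esub> e'"] that ZcE by auto
    qed
  qed (rule ZcE)
  have cZc [simp]: "carrier (subgroup_generated E Zc) = Zc"
    using sZc subgroup.carrier_subgroup_generated_subgroup by blast
  have rc: "N #>\<^bsub>subgroup_generated C Z\<^esub> z = N #>\<^bsub>C\<^esub> z" for z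
    by (simp add: r_coset_def)
  have cH: "carrier H = (\<lambda>z. N #>\<^bsub>C\<^esub> z) ` Z"
    by (simp add: H_def carrier_FactGroup rc)
  \<comment> \<open>For \<open>e\<close> in \<open>Zc\<close> the homomorphism
    \<open>\<theta> e\<close> is trivial on \<open>N\<close>, hence constant on each coset of
    \<open>N\<close>; \<open>the_elem\<close> extracts that value.\<close>
  define F where "F = (\<lambda>e. \<lambda>X\<in>carrier H. the_elem (\<theta> e ` X))"
  have Fz: "F e (N #>\<^bsub>C\<^esub> z) = \<theta> e z" if e: "e \<in> Zc" and z: "z \<in> Z" for e z
  proof -
    have "\<theta> e (n \<otimes>\<^bsub>C\<^esub> z) = \<theta> e z" if "n \<in> N" for n
    proof -
      have "\<theta> e (n \<otimes>\<^bsub>C\<^esub> z) = \<theta> e n \<otimes>\<^bsub>A\<^esub> \<theta> e z"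
        using \<theta>C e z ZcE NC ZC that by (auto intro!: hom_mult)
      moreover have "\<theta> e z \<in> carrier A"
        using \<theta>C e z ZcE ZC by (meson hom_in_carrier subsetD)
      ultimately show ?thesis
        using Zc e ZcE that by auto
    qed
    then have "\<theta> e ` (N #>\<^bsub>C\<^esub> z) \<subseteq> {\<theta> e z}"
      by (auto simp: r_coset_def)
    moreover have "z \<in> N #>\<^bsub>C\<^esub> z"
      using C.rcos_self [OF ZC [OF z] N] .
    ultimately have "\<theta> e ` (N #>\<^bsub>C\<^esub> z) = {\<theta> e z}"
      by blast
    then show ?thesis
      using z by (simp add: F_def cH)
  qed
  have FH: "F e \<in> carrier (Hom_group H A)" if e: "e \<in> Zc" for e
  proof -
    have eE: "e \<in> carrier E"
      using e ZcE by blast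
    have "F e \<in> hom H A"
    proof (rule homI)
      fix X assume "X \<in> carrier H"
      then show "F e X \<in> carrier A"
        using Fz [OF e] \<theta>C [OF eE] ZC by (auto simp: cH hom_in_carrier)
    next
      fix X Y assume "X \<in> carrier H" "Y \<in> carrier H"
      then obtain x y where xy: "x \<in> Z" "y \<in> Z" "X = N #>\<^bsub>C\<^esub> x" "Y = N #>\<^bsub>C\<^esub> y"
        by (auto simp: cH)
      have "X \<otimes>\<^bsub>H\<^esub> Y = N #>\<^bsub>C\<^esub> (x \<otimes>\<^bsub>C\<^esub> y)"
        using nN.rcos_sum [of x y] xy by (simp add: H_def rc)
      moreover have "x \<otimes>\<^bsub>C\<^esub> y \<in> Z"
        using xy sZ by (simp add: subgroup.m_closed)
      ultimately show "F e (X \<otimes>\<^bsub>H\<^esub> Y) = F e X \<otimes>\<^bsub>A\<^esub> F e Y"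
        using xy Fz [OF e] ZC \<theta>C [OF eE] by (simp add: hom_mult)
    qed
    then show ?thesis
      by (simp add: carrier_Hom_group F_def)
  qed
  have F: "F \<in> hom (subgroup_generated E Zc) (Hom_group H A)"
  proof (rule homI)
    fix e e' assume "e \<in> carrier (subgroup_generated E Zc)" "e' \<in> carrier (subgroup_generated E Zc)"
    then have ee: "e \<in> Zc" "e' \<in> Zc" "e \<otimes>\<^bsub>E\<^esub> e' \<in> Zc"
      using sZc by (auto simp: subgroup.m_closed)
    show "F (e \<otimes>\<^bsub>subgroup_generated E Zc\<^esub> e') = F e \<otimes>\<^bsub>Hom_group H A\<^esub> F e'"
    proof
      fix X show "F (e \<otimes>\<^bsub>subgroup_generated E Zc\<^esub> e') X = (F e \<otimes>\<^bsub>Hom_group H A\<^esub> F e') X"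
      proof (cases "X \<in> carrier H")
        case True
        then obtain x where x: "x \<in> Z" "X = N #>\<^bsub>C\<^esub> x"
          by (auto simp: cH)
        then show ?thesis
          using True ee Fz ZC \<theta>m [of e e' x] ZcE by (auto simp: mult_Hom_group)
      qed (simp add: F_def mult_Hom_group)
    qed
  qed (simp add: FH)
  interpret F: group_hom "subgroup_generated E Zc" "Hom_group H A" F
    using F HomA comm_group.axioms(2) by (auto simp: group_hom_def group_hom_axioms_def)
  have onto: "F ` carrier (subgroup_generated E Zc) = carrier (Hom_group H A)"
  proof (intro equalityI subsetI)
    fix h assume h: "h \<in> carrier (Hom_group H A)"
    then have hH: "h \<in> hom H A"
      by (simp add: carrier_Hom_group)
    define r where "r = (\<lambda>c. c \<otimes>\<^bsub>C\<^esub> inv\<^bsub>C\<^esub> K (d c))"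
    have rZ: "r c \<in> Z" if "c \<in> carrier C" for c
      using that dKd by (simp add: r_def Z_def kernel_def)
    have r: "r \<in> hom C (subgroup_generated C Z)"
      using rZ by (intro homI) (auto simp: r_def C.inv_mult C.m_ac)
    have hc: "(\<lambda>c. h (N #>\<^bsub>C\<^esub> r c)) \<in> hom C A"
      using hom_compose [OF hom_compose [OF r nN.r_coset_hom_Mod] hH [unfolded H_def]]
      by (simp add: comp_def rc)
    define f where "f = (\<lambda>c\<in>carrier C. h (N #>\<^bsub>C\<^esub> r c))"
    have "f \<in> carrier (Hom_group C A)"
      unfolding f_def by (rule restrict_in_Hom_group [OF C.is_group hc])
    then obtain e where e: "e \<in> carrier E" "\<theta> e = f"
    proof -
      have "\<theta> ` carrier E = carrier (Hom_group C A)"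
        using \<theta> by (simp add: iso_def bij_betw_def)
      then show ?thesis
        using \<open>f \<in> carrier (Hom_group C A)\<close> that by (metis imageE)
    qed
    have rz: "r z = z" if "z \<in> Z" for z
      using that by (simp add: r_def Z_def kernel_def)
    have fZ: "f z = h (N #>\<^bsub>C\<^esub> z)" if "z \<in> Z" for z
      using that by (simp add: f_def rz ZC)
    have "f n = \<one>\<^bsub>A\<^esub>" if n: "n \<in> N" for n
    proof -
      have "N #>\<^bsub>C\<^esub> n = \<one>\<^bsub>H\<^esub>"
        using n N C.is_group NC by (simp add: H_def C.coset_join2)
      then show ?thesis
        using n NZ fZ hH gH A.is_group by (metis Z_def hom_one subsetD)
    qed
    then have eZ: "e \<in> Zc"
      using Zc e by blast
    have "F e = h"
    proof
      fix X show "F e X = h X"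
      proof (cases "X \<in> carrier H")
        case True
        then show ?thesis
          using Fz [OF eZ] fZ e by (auto simp: cH)
      next
        case False
        then show ?thesis
          using h by (simp add: F_def carrier_Hom_group extensional_def)
      qed
    qed
    then show "h \<in> F ` carrier (subgroup_generated E Zc)"
      using eZ by force
  qed (use FH in auto)
  have ker: "kernel (subgroup_generated E Zc) (Hom_group H A) F = Bc"
  proof -
    have "e \<in> Bc" if e: "e \<in> Zc" and F1: "F e = \<one>\<^bsub>Hom_group H A\<^esub>" for e
    proof -
      have eE: "e \<in> carrier E"
        using e ZcE by blast
      have z1: "\<theta> e z = \<one>\<^bsub>A\<^esub>" if "z \<in> Z" for z
        using Fz [OF e that] F1 that by (simp add: one_Hom_group cH)
      \<comment> \<open>Being trivial on cycles, \<open>\<theta> e\<close> cannot distinguish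
        \<open>c\<close> from \<open>K (d c)\<close>; so it factors through \<open>d\<close> by way
        of \<open>\<theta> e \<circ> K\<close>.\<close>
      have "\<theta> e c = \<theta> e (K (d c))" if c: "c \<in> carrier C" for c
      proof -
        have "c \<otimes>\<^bsub>C\<^esub> inv\<^bsub>C\<^esub> K (d c) \<in> Z"
          using c dKd by (simp add: Z_def kernel_def)
        then have "\<theta> e (c \<otimes>\<^bsub>C\<^esub> inv\<^bsub>C\<^esub> K (d c) \<otimes>\<^bsub>C\<^esub> K (d c)) = \<one>\<^bsub>A\<^esub> \<otimes>\<^bsub>A\<^esub> \<theta> e (K (d c))"
          using hom_mult [OF \<theta>C [OF eE]] z1 ZC c by simp
        moreover have "\<theta> e (K (d c)) \<in> carrier A"
          using \<theta>C [OF eE] c by (simp add: hom_in_carrier)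
        ultimately show ?thesis
          using c by (simp add: C.m_assoc)
      qed
      moreover have "\<theta> e \<circ> K \<in> hom C0 A"
        using hom_compose [OF K \<theta>C [OF eE]] .
      ultimately show ?thesis
        using Bc [OF eE] by force
    qed
    moreover have "e \<in> Zc \<and> F e = \<one>\<^bsub>Hom_group H A\<^esub>" if e: "e \<in> Bc" for e
    proof -
      have eE: "e \<in> carrier E"
        using e BcE by blast
      obtain g where g: "g \<in> hom C0 A" "\<And>c. c \<in> carrier C \<Longrightarrow> \<theta> e c = g (d c)"
        using Bc [OF eE] e by blast
      have z1: "\<theta> e z = \<one>\<^bsub>A\<^esub>" if "z \<in> Z" for z
        using that g hom_one [OF g(1) C0 A.is_group] by (simp add: Z_def kernel_def)
      then have eZ: "e \<in> Zc"
        using Zc [OF eE] NZ by (auto simp: Z_def)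
      moreover have "F e = \<one>\<^bsub>Hom_group H A\<^esub>"
      proof
        fix X show "F e X = \<one>\<^bsub>Hom_group H A\<^esub> X"
          by (cases "X \<in> carrier H") (use Fz [OF eZ] z1 in \<open>auto simp: cH one_Hom_group F_def\<close>)
      qed
      ultimately show ?thesis ..
    qed
    ultimately show ?thesis
      by (auto simp: kernel_def)
  qed
  have "group (subgroup_generated E Zc Mod Bc)"
    using normal.factorgroup_is_group [OF F.normal_kernel] by (simp only: ker)
  moreover have "subgroup_generated E Zc Mod Bc \<cong> Hom_group H A"
    using F.FactGroup_iso [OF onto] by (simp only: ker)
  ultimately show ?thesis
    unfolding H_def Z_def by (rule group.iso_sym)
qed

section \<open>Homomorphisms on a free Abelian group and functions on its basis\<close>

lemma hom_free_Abelian_group_diff: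
  assumes A: "group A" and h: "h \<in> hom (free_Abelian_group S) A"
    and xy: "Poly_Mapping.keys x \<subseteq> S" "Poly_Mapping.keys y \<subseteq> S"
  shows "h (x - y) = h x \<otimes>\<^bsub>A\<^esub> inv\<^bsub>A\<^esub> h y"
proof -
  interpret h: group_hom "free_Abelian_group S" A h
    using A h by (simp add: group_hom_def group_hom_axioms_def)
  have "h (x + - y) = h x \<otimes>\<^bsub>A\<^esub> inv\<^bsub>A\<^esub> h y"
    using h.hom_mult [of x "- y"] h.hom_inv [of y] xy by simp
  then show ?thesis
    by simp
qed

lemma hom_free_Abelian_group_eq:
  assumes A: "group A" and h: "h \<in> hom (free_Abelian_group S) A" "h' \<in> hom (free_Abelian_group S) A"
    and eq: "\<And>x. x \<in> S \<Longrightarrow> h (frag_of x) = h' (frag_of x)" and c: "Poly_Mapping.keys c \<subseteq> S"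
  shows "h c = h' c"
proof -
  \<comment> \<open>The support condition is part of the induction claim, because a difference may
    be evaluated termwise only when both terms lie in the group.\<close>
  have "Poly_Mapping.keys c \<subseteq> S \<and> h c = h' c"
    using c
  proof (induction c rule: frag_induction)
    case zero
    then show ?case
      using hom_one [OF h(1) group_free_Abelian_group A] hom_one [OF h(2) group_free_Abelian_group A] by simp
  next
    case (diff a b)
    then show ?case
      using hom_free_Abelian_group_diff [OF A h(1), of a b] hom_free_Abelian_group_diff [OF A h(2), of a b]
        keys_diff [of a b] by auto
  qed (use eq in auto)
  then show ?thesis ..
qed

text \<open>The universal property extends each function on \<open>S\<close>, and \<theta> chooses
  such an extension. Homomorphisms are determined by their values on the basis, so evaluation there
  is the inverse of \<theta>, and multiplicativity can be checked there too.\<close>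

lemma product_group_iso_Hom_group:
  assumes A: "comm_group A"
  obtains \<theta> where "\<theta> \<in> iso (product_group S (\<lambda>_. A)) (Hom_group (free_Abelian_group S) A)"
    "\<And>v x. v \<in> carrier (product_group S (\<lambda>_. A)) \<Longrightarrow> x \<in> S \<Longrightarrow> \<theta> v (frag_of x) = v x"
proof -
  interpret A: comm_group A by fact
  let ?F = "free_Abelian_group S" and ?P = "product_group S (\<lambda>_. A)"
  have "\<exists>h. h \<in> carrier (Hom_group ?F A) \<and> (\<forall>x\<in>S. h (frag_of x) = v x)" if v: "v \<in> carrier ?P" for v
  proof -
    have "v ` S \<subseteq> carrier A"
      using v by auto
    then obtain h where "h \<in> hom ?F A" "\<And>x. x \<in> S \<Longrightarrow> h (frag_of x) = v x"
      using A.free_Abelian_group_universal by blast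
    then show ?thesis
      using restrict_in_Hom_group [OF group_free_Abelian_group]
      by (intro exI [of _ "restrict h (carrier ?F)"]) auto
  qed
  then obtain \<theta> where \<theta>: "\<And>v. v \<in> carrier ?P \<Longrightarrow> \<theta> v \<in> carrier (Hom_group ?F A)"
    and \<theta>x: "\<And>v x. v \<in> carrier ?P \<Longrightarrow> x \<in> S \<Longrightarrow> \<theta> v (frag_of x) = v x"
    by metis
  have hom_ext: "f = g" if fg: "f \<in> carrier (Hom_group ?F A)" "g \<in> carrier (Hom_group ?F A)"
    and eq: "\<And>x. x \<in> S \<Longrightarrow> f (frag_of x) = g (frag_of x)" for f g
  proof (rule extensionalityI)
    show "f \<in> extensional (carrier ?F)" "g \<in> extensional (carrier ?F)"
      using fg by (auto simp: carrier_Hom_group)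
    show "f c = g c" if "c \<in> carrier ?F" for c
    proof -
      have "f \<in> hom ?F A" "g \<in> hom ?F A" "Poly_Mapping.keys c \<subseteq> S"
        using fg that by (auto simp: carrier_Hom_group)
      from hom_free_Abelian_group_eq [OF A.is_group this(1,2) eq this(3)] show ?thesis .
    qed
  qed
  have P: "group ?P"
    by (simp add: A.is_group)
  have H: "comm_group (Hom_group ?F A)"
    by (simp add: A comm_group_Hom_group)
  have "\<theta> \<in> hom ?P (Hom_group ?F A)"
  proof (rule homI)
    fix v w assume v: "v \<in> carrier ?P" and w: "w \<in> carrier ?P"
    then have vw: "v \<otimes>\<^bsub>?P\<^esub> w \<in> carrier ?P"
      using P by (simp only: group.is_monoid monoid.m_closed)
    show "\<theta> (v \<otimes>\<^bsub>?P\<^esub> w) = \<theta> v \<otimes>\<^bsub>Hom_group ?F A\<^esub> \<theta> w"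
    proof (rule hom_ext)
      show "\<theta> v \<otimes>\<^bsub>Hom_group ?F A\<^esub> \<theta> w \<in> carrier (Hom_group ?F A)"
        using H \<theta> v w by (simp add: comm_group_def group.is_monoid monoid.m_closed)
      fix x assume "x \<in> S"
      then show "\<theta> (v \<otimes>\<^bsub>?P\<^esub> w) (frag_of x) = (\<theta> v \<otimes>\<^bsub>Hom_group ?F A\<^esub> \<theta> w) (frag_of x)"
        using \<theta>x [OF vw] \<theta>x [OF v] \<theta>x [OF w] by (simp add: mult_Hom_group)
    qed (rule \<theta> [OF vw])
  qed (rule \<theta>)
  moreover have "bij_betw \<theta> (carrier ?P) (carrier (Hom_group ?F A))"
  proof (rule bij_betw_byWitness [where f' = "\<lambda>h. \<lambda>x\<in>S. h (frag_of x)"])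
    show "\<forall>v\<in>carrier ?P. (\<lambda>x\<in>S. \<theta> v (frag_of x)) = v"
      using \<theta>x by (fastforce simp: PiE_def extensional_def)
    have *: "(\<lambda>x\<in>S. h (frag_of x)) \<in> carrier ?P" if "h \<in> carrier (Hom_group ?F A)" for h
      using that by (auto simp: carrier_Hom_group intro: hom_in_carrier)
    then show "(\<lambda>h. \<lambda>x\<in>S. h (frag_of x)) ` carrier (Hom_group ?F A) \<subseteq> carrier ?P"
      by blast
    show "\<forall>h\<in>carrier (Hom_group ?F A). \<theta> (\<lambda>x\<in>S. h (frag_of x)) = h"
    proof
      fix h assume h: "h \<in> carrier (Hom_group ?F A)"
      show "\<theta> (\<lambda>x\<in>S. h (frag_of x)) = h"
        by (rule hom_ext [OF \<theta> [OF * [OF h]] h]) (simp add: \<theta>x [OF * [OF h]])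
    qed
  qed (use \<theta> in blast)
  ultimately show ?thesis
    using that \<theta>x by (simp add: iso_def)
qed

section \<open>Singular cycles of degree one\<close>

text \<open>The coordinate \<open>x 1\<close> is the time parameter, so the vertex e_0 is the start
  and e_1 the end. The restriction makes the map extensional, as singular simplices are required to
  be.\<close>

definition singular_path :: "(real \<Rightarrow> 'a) \<Rightarrow> (nat \<Rightarrow> real) \<Rightarrow> 'a" where
  "singular_path g = (\<lambda>x\<in>standard_simplex 1. g (x 1))"

definition singular_point :: "'a \<Rightarrow> (nat \<Rightarrow> real) \<Rightarrow> 'a" where
  "singular_point a = (\<lambda>x\<in>standard_simplex 0. a)"

text \<open>The value at the vertex e_0. On a 0-simplex this is its only point, so the same
  expression reads the points off a 0-chain.\<close>

abbreviation simplex_start :: "((nat \<Rightarrow> real) \<Rightarrow> 'a) \<Rightarrow> 'a" where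
  "simplex_start f \<equiv> f (\<lambda>i. if i = 0 then 1 else 0)"

abbreviation simplex_end :: "((nat \<Rightarrow> real) \<Rightarrow> 'a) \<Rightarrow> 'a" where
  "simplex_end f \<equiv> f (\<lambda>i. if i = 1 then 1 else 0)"

lemma standard_simplex_1:
  "x \<in> standard_simplex 1 \<longleftrightarrow> (\<forall>i. 0 \<le> x i \<and> x i \<le> 1) \<and> (\<forall>i>1. x i = 0) \<and> x 0 + x 1 = 1"
  by (simp add: standard_simplex_def One_nat_def)

lemma standard_simplex_1_coord: "x \<in> standard_simplex 1 \<Longrightarrow> x 1 \<in> {0..1}"
  by (auto simp: standard_simplex_def)

lemma singular_path_cong: "(\<And>t. t \<in> {0..1} \<Longrightarrow> g t = h t) \<Longrightarrow> singular_path g = singular_path h"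
  using standard_simplex_1_coord by (auto simp: singular_path_def)

lemma singular_path_ends [simp]:
  "simplex_start (singular_path g) = g 0" "simplex_end (singular_path g) = g 1"
  by (simp_all add: singular_path_def)

lemma singular_simplex_path:
  assumes "pathin X g"
  shows "singular_simplex 1 X (singular_path g)"
proof -
  let ?S = "subtopology (powertop_real UNIV) (standard_simplex 1)"
  have "continuous_map ?S euclideanreal (\<lambda>x. x 1)"
    by (intro continuous_map_from_subtopology continuous_map_product_projection) auto
  then have "continuous_map ?S (top_of_set {0..1}) (\<lambda>x. x 1)"
    using standard_simplex_1_coord by (auto simp: continuous_map_in_subtopology)
  from continuous_map_compose [OF this] assms have "continuous_map ?S X (\<lambda>x. g (x 1))"
    by (auto simp: pathin_def comp_def)
  then have "continuous_map ?S X (singular_path g)"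
    by (rule continuous_map_eq) (auto simp: singular_path_def)
  then show ?thesis
    by (simp add: singular_simplex_def singular_path_def)
qed

lemma singular_chain_path: "pathin X g \<Longrightarrow> singular_chain 1 X (frag_of (singular_path g))"
  by (simp add: singular_chain_of singular_simplex_path)

lemma simplex_map_path: "simplex_map 1 f (singular_path g) = singular_path (f \<circ> g)"
  by (auto simp: simplex_map_def singular_path_def)

text \<open>Face i omits vertex i, so face 0 is the end point. The orientation is the one that
  \<open>face1_0\<close> and \<open>face1_1\<close> give to a net simplex.\<close>

lemma singular_face_1:
  "singular_face 1 0 f = singular_point (simplex_end f)"
  "singular_face 1 1 f = singular_point (simplex_start f)"
proof -
  have "simplical_face 0 (\<lambda>j. if j = 0 then 1 else 0) = (\<lambda>i. if i = 1 then 1 else 0 :: real)"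
    "simplical_face 1 (\<lambda>j. if j = 0 then 1 else 0) = (\<lambda>i. if i = 0 then 1 else 0 :: real)"
    by (auto simp: simplical_face_def fun_eq_iff)
  then show "singular_face 1 0 f = singular_point (simplex_end f)"
    "singular_face 1 1 f = singular_point (simplex_start f)"
    by (auto simp: singular_face_def singular_point_def standard_simplex_0 intro!: restrict_ext)
qed

lemma chain_boundary_1:
  "chain_boundary 1 (frag_of f)
   = frag_of (singular_point (simplex_end f)) - frag_of (singular_point (simplex_start f))"
proof -
  have "{..1} = {0, 1::nat}"
    by auto
  then show ?thesis
    by (simp add: chain_boundary_of singular_face_1)
qed

lemma chain_boundary_path:
  "chain_boundary 1 (frag_of (singular_path g))
   = frag_of (singular_point (g 1)) - frag_of (singular_point (g 0))"
  by (simp only: chain_boundary_1 singular_path_ends)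

lemma singular_simplex_0_iff: "singular_simplex 0 X f \<longleftrightarrow> (\<exists>a\<in>topspace X. f = singular_point a)"
proof
  assume f: "singular_simplex 0 X f"
  then have "simplex_start f \<in> topspace X"
    by (auto simp: singular_simplex_def continuous_map_def Pi_iff)
  moreover have "f = singular_point (simplex_start f)"
    using f by (force simp: singular_point_def singular_simplex_def standard_simplex_0 extensional_def)
  ultimately show "\<exists>a\<in>topspace X. f = singular_point a"
    by blast
next
  have "continuous_map (subtopology (powertop_real UNIV) (standard_simplex 0)) X (singular_point a)"
    if "a \<in> topspace X" for a
    by (rule continuous_map_eq [of _ _ "\<lambda>_. a"]) (use that in \<open>auto simp: singular_point_def\<close>)
  then show "\<exists>a\<in>topspace X. f = singular_point a \<Longrightarrow> singular_simplex 0 X f"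
    by (auto simp: singular_simplex_def singular_point_def)
qed

lemma singular_point_start [simp]: "simplex_start (singular_point a) = a"
  by (simp add: singular_point_def)

text \<open>The last clause records that the path stays where the simplex does; it is needed when a
  simplex lies in two members of the base at once.\<close>

lemma singular_simplex_1_path:
  assumes f: "singular_simplex 1 X f"
  obtains g where "pathin X g" "f = singular_path g" "g \<in> {0..1} \<rightarrow> f ` standard_simplex 1"
proof
  \<comment> \<open>The parametrization t \<mapsto> (1 - t, t, 0, ...) of the standard simplex,
    inverse to the coordinate \<open>x 1\<close>.\<close>
  define v :: "real \<Rightarrow> nat \<Rightarrow> real" where "v = (\<lambda>t i. if i = 0 then 1 - t else if i = 1 then t else 0)"
  have v: "v t \<in> standard_simplex 1" if "t \<in> {0..1}" for t
    using that by (auto simp: v_def standard_simplex_1)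
  have "continuous_map (top_of_set {0..1}) (powertop_real UNIV) v"
    unfolding continuous_map_componentwise_UNIV
  proof
    fix i :: nat
    consider "i = 0" | "i = 1" | "i > 1"
      by linarith
    then show "continuous_map (top_of_set {0..1}) euclideanreal (\<lambda>t. v t i)"
      by cases (auto simp: v_def intro!: continuous_intros)
  qed
  then have "continuous_map (top_of_set {0..1})
      (subtopology (powertop_real UNIV) (standard_simplex 1)) v"
    using v by (auto simp: continuous_map_in_subtopology)
  then show "pathin X (f \<circ> v)"
    using f by (auto simp: pathin_def singular_simplex_def intro: continuous_map_compose)
  show "f \<circ> v \<in> {0..1} \<rightarrow> f ` standard_simplex 1"
    using v by auto
  have vx: "v (x 1) = x" if "x \<in> standard_simplex 1" for x
  proof
    fix i show "v (x 1) i = x i"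
      using that by (cases "i > 1") (auto simp: v_def standard_simplex_1 not_less le_eq_less_or_eq)
  qed
  show "f = singular_path (f \<circ> v)"
  proof
    fix x show "f x = singular_path (f \<circ> v) x"
      using f vx [of x] by (cases "x \<in> standard_simplex 1")
        (auto simp: singular_path_def singular_simplex_def extensional_def)
  qed
qed

lemma simplex_ends_in_topspace:
  assumes "singular_simplex 1 X f"
  shows "simplex_start f \<in> topspace X" "simplex_end f \<in> topspace X"
  using assms by (auto simp: singular_simplex_def continuous_map_def Pi_iff)

section \<open>Relations between paths, obtained from contractible models\<close>

lemma contractible_imp_singular_boundary:
  assumes X: "contractible_space X" and c: "singular_relcycle 1 X {} c"
  shows "singular_relboundary 1 X {} c"
proof -
  have "trivial_group (homology_group 1 X)"
    using trivial_reduced_homology_group_contractible_space [OF X, of 1]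
    by (simp add: un_reduced_homology_group)
  then have "homologous_rel_set 1 X {} ` singular_relcycle_set 1 X {} = {singular_relboundary_set 1 X {}}"
    using carrier_relative_homology_group [of 1 X "{}"] one_relative_homology_group [of 1 X "{}"]
    by (simp add: trivial_group_def)
  moreover have "homologous_rel_set 1 X {} c \<in> homologous_rel_set 1 X {} ` singular_relcycle_set 1 X {}"
    using c by (intro imageI) simp
  ultimately have "homologous_rel_set 1 X {} c = singular_relboundary_set 1 X {}"
    by simp
  then show ?thesis
    using homologous_rel_set_eq_relboundary by blast
qed

text \<open>This replaces explicit 2-chains: a relation between paths is written as a cycle in the
  interval or the square, where it bounds, and the filling is transported by
  \<open>f\<close>.\<close>

lemma chain_map_contractible_boundary:
  assumes "contractible_space Q" "continuous_map Q X f" "singular_relcycle 1 Q {} z"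
  shows "singular_relboundary 1 X {} (chain_map 1 f z)"
  using singular_relboundary_chain_map [OF contractible_imp_singular_boundary] assms by blast

lemma contractible_interval: "contractible_space (top_of_set {0..1::real})"
  unfolding contractible_space_top_of_set by (rule convex_imp_contractible [OF convex_real_interval(5)])

text \<open>Degenerate simplices are not divided out of the singular chains, so a constant path is a
  nonzero chain and has to be filled.\<close>

lemma singular_boundary_const_path:
  assumes "a \<in> topspace X"
  shows "singular_relboundary 1 X {} (frag_of (singular_path (\<lambda>_. a)))"
proof -
  let ?z = "frag_of (singular_path (\<lambda>_. 0::real))"
  have "singular_relcycle 1 (top_of_set {0..1}) {} ?z"
    using singular_chain_path [of "top_of_set {0..1}" "\<lambda>_. 0::real"]
    by (simp add: singular_cycle chain_boundary_path)
  then have "singular_relboundary 1 X {} (chain_map 1 (\<lambda>_. a) ?z)"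
    using assms by (intro chain_map_contractible_boundary [OF contractible_interval]) auto
  then show ?thesis
    by (simp add: simplex_map_path comp_def)
qed

lemma path_join_homologous:
  assumes g1: "pathin X g1" and g2: "pathin X g2" and eq: "g1 1 = g2 0"
  obtains g where "pathin X g" "g 0 = g1 0" "g 1 = g2 1"
    "singular_relboundary 1 X {}
       (frag_of (singular_path g1) + frag_of (singular_path g2) - frag_of (singular_path g))"
proof -
  let ?I = "top_of_set {0..1::real}"
  define g where "g = (\<lambda>x. if x \<le> 1/2 then (g1 \<circ> (\<lambda>t. 2 * t)) x else (g2 \<circ> (\<lambda>t. 2 * t -1)) x)"
  have g: "continuous_map ?I X g"
    unfolding g_def
  proof (intro continuous_map_cases_le continuous_map_compose, force, force)
    show "continuous_map (subtopology ?I {x \<in> topspace ?I. x \<le> 1/2}) ?I ((*) 2)"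
      by (auto simp: continuous_map_in_subtopology continuous_map_from_subtopology)
    have "continuous_map (subtopology ?I {x. 0 \<le> x \<and> x \<le> 1 \<and> 1 \<le> x * 2}) euclideanreal (\<lambda>t. 2 * t - 1)"
      by (intro continuous_intros) (force intro: continuous_map_from_subtopology)
    then show "continuous_map (subtopology ?I {x \<in> topspace ?I. 1/2 \<le> x}) ?I (\<lambda>t. 2 * t - 1)"
      by (force simp: continuous_map_in_subtopology)
    show "(g1 \<circ> (*) 2) x = (g2 \<circ> (\<lambda>t. 2 * t - 1)) x" if "x \<in> topspace ?I" "x = 1/2" for x
    proof -
      have "2 * x = 1"
        using that by simp
      then show ?thesis
        by (simp add: eq)
    qed
  qed (use g1 g2 in \<open>auto simp: pathin_def\<close>)
  \<comment> \<open>The two halves of the interval and the whole of it. \<open>g\<close> carries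
    them to \<open>g1\<close>, \<open>g2\<close> and itself, and the relation between them is
    already a cycle in the interval.\<close>
  let ?a = "\<lambda>t::real. t / 2" and ?b = "\<lambda>t::real. (t + 1) / 2" and ?c = "\<lambda>t::real. t"
  let ?z = "frag_of (singular_path ?a) + frag_of (singular_path ?b) - frag_of (singular_path ?c)"
  have "pathin ?I ?a" "pathin ?I ?b" "pathin ?I ?c"
    by (auto simp: pathin_def continuous_on_def intro!: tendsto_intros)
  then have "singular_relcycle 1 ?I {} ?z"
    by (auto simp: singular_cycle chain_boundary_add chain_boundary_diff chain_boundary_path
        intro!: singular_chain_add singular_chain_diff singular_chain_path)
  then have "singular_relboundary 1 X {} (chain_map 1 g ?z)"
    by (rule chain_map_contractible_boundary [OF contractible_interval g])
  moreover have "singular_path (g \<circ> ?a) = singular_path g1"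
    by (rule singular_path_cong) (auto simp: g_def)
  moreover have "singular_path (g \<circ> ?b) = singular_path g2"
  proof (rule singular_path_cong)
    fix t :: real assume t: "t \<in> {0..1}"
    have "2 * ((t + 1) / 2) - 1 = t" "2 * (1 / 2) = (1::real)"
      by (simp_all add: field_simps)
    \<comment> \<open>At \<open>t = 0\<close> the midpoint falls to the first branch of
      \<open>g\<close>, whose value \<open>g1 1\<close> equals \<open>g2 0\<close>.\<close>
    then show "(g \<circ> ?b) t = g2 t"
      using t eq by (cases "t = 0") (simp_all only: g_def comp_def, auto)
  qed
  ultimately have "singular_relboundary 1 X {}
       (frag_of (singular_path g1) + frag_of (singular_path g2) - frag_of (singular_path g))"
    by (simp add: chain_map_add chain_map_diff simplex_map_path comp_def)
  moreover have "g 0 = g1 0" "g 1 = g2 1"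
    by (simp_all add: g_def)
  ultimately show ?thesis
    using that g by (simp add: pathin_def)
qed

lemma path_reverse_homologous:
  assumes g: "pathin X g"
  shows "pathin X (\<lambda>t. g (1 - t))"
    and "singular_relboundary 1 X {}
           (frag_of (singular_path g) + frag_of (singular_path (\<lambda>t. g (1 - t))))"
proof -
  let ?I = "top_of_set {0..1::real}"
  let ?b = "\<lambda>t::real. 1 - t" and ?c = "\<lambda>t::real. t"
  let ?z = "frag_of (singular_path ?c) + frag_of (singular_path ?b)"
  have p: "pathin ?I ?b" "pathin ?I ?c"
    by (auto simp: pathin_def continuous_on_def intro!: tendsto_intros)
  then show "pathin X (\<lambda>t. g (1 - t))"
    using continuous_map_compose [of ?I ?I ?b X g] g by (auto simp: pathin_def comp_def)
  from p have "singular_relcycle 1 ?I {} ?z"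
    by (auto simp: singular_cycle chain_boundary_add chain_boundary_path
        intro!: singular_chain_add singular_chain_path)
  then have "singular_relboundary 1 X {} (chain_map 1 g ?z)"
    using g by (intro chain_map_contractible_boundary [OF contractible_interval]) (auto simp: pathin_def)
  then show "singular_relboundary 1 X {}
           (frag_of (singular_path g) + frag_of (singular_path (\<lambda>t. g (1 - t))))"
    by (simp add: chain_map_add simplex_map_path comp_def)
qed

lemma simply_connected_loop_boundary:
  assumes X: "simply_connected_space X" and g: "pathin X g" "g 0 = g 1"
  shows "singular_relboundary 1 X {} (frag_of (singular_path g))"
proof -
  let ?I = "top_of_set {0..1::real}"
  let ?Q = "prod_topology ?I ?I"
  have "homotopic_with (\<lambda>h. h 0 = g 0 \<and> h 1 = g 0) ?I X g (\<lambda>_. g 0)"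
    using X g by (auto simp: simply_connected_space_def)
  then obtain h where h: "continuous_map ?Q X h" and h0: "\<And>x. h (0, x) = g x"
    and h1: "\<And>x. h (1, x) = g 0" and he: "\<And>t. t \<in> {0..1} \<Longrightarrow> h (t, 0) = g 0 \<and> h (t, 1) = g 0"
    by (auto simp: homotopic_with_def)
  \<comment> \<open>The sides of the square: \<open>?a + ?b\<close> and \<open>?c + ?d\<close> are
    the two ways from (0,0) to (1,1). The homotopy is \<open>g\<close> on \<open>?a\<close> and
    constant on the other three sides, two of which cancel.\<close>
  let ?a = "\<lambda>t::real. (0::real, t)" and ?b = "\<lambda>t::real. (t, 1::real)"
    and ?c = "\<lambda>t::real. (t, 0::real)" and ?d = "\<lambda>t::real. (1::real, t)"
  let ?z = "frag_of (singular_path ?a) + frag_of (singular_path ?b)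
            - frag_of (singular_path ?c) - frag_of (singular_path ?d)"
  have "pathin ?Q ?a" "pathin ?Q ?b" "pathin ?Q ?c" "pathin ?Q ?d"
    by (auto simp: pathin_def continuous_map_pairwise comp_def intro!: continuous_on_Pair)
  then have "singular_relcycle 1 ?Q {} ?z"
    by (auto simp: singular_cycle chain_boundary_add chain_boundary_diff chain_boundary_path
        intro!: singular_chain_add singular_chain_diff singular_chain_path)
  moreover have "contractible_space ?Q"
    using contractible_interval contractible_space_prod_topology by blast
  ultimately have "singular_relboundary 1 X {} (chain_map 1 h ?z)"
    using h chain_map_contractible_boundary by blast
  moreover have "singular_path (h \<circ> ?b) = singular_path (\<lambda>_. g 0)"
    "singular_path (h \<circ> ?c) = singular_path (\<lambda>_. g 0)"
    using he by (auto intro!: singular_path_cong)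
  moreover have "h \<circ> ?a = g" "h \<circ> ?d = (\<lambda>_. g 0)"
    using h0 h1 by auto
  ultimately have "singular_relboundary 1 X {} (frag_of (singular_path g) - frag_of (singular_path (\<lambda>_. g 0)))"
    by (simp add: chain_map_add chain_map_diff simplex_map_path)
  moreover have "singular_relboundary 1 X {} (frag_of (singular_path (\<lambda>_. g 0)))"
    by (intro singular_boundary_const_path path_start_in_topspace [OF g(1)])
  ultimately show ?thesis
    using singular_relboundary_add by fastforce
qed

text \<open>\<open>g\<close> followed by the reverse of \<open>h\<close> is a loop and hence bounds;
  joining is addition and reversal is negation modulo boundaries.\<close>

lemma simply_connected_paths_homologous:
  assumes X: "simply_connected_space X" and g: "pathin X g" and h: "pathin X h"
    and eq: "g 0 = h 0" "g 1 = h 1"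
  shows "singular_relboundary 1 X {} (frag_of (singular_path g) - frag_of (singular_path h))"
proof -
  let ?r = "\<lambda>t. h (1 - t)"
  have r: "pathin X ?r" and rb: "singular_relboundary 1 X {} (frag_of (singular_path h) + frag_of (singular_path ?r))"
    using path_reverse_homologous [OF h] by auto
  obtain k where k: "pathin X k" "k 0 = g 0" "k 1 = ?r 1"
    and kb: "singular_relboundary 1 X {}
       (frag_of (singular_path g) + frag_of (singular_path ?r) - frag_of (singular_path k))"
    using path_join_homologous [OF g r] eq by auto
  have "singular_relboundary 1 X {} (frag_of (singular_path k))"
    using simply_connected_loop_boundary [OF X] k eq by auto
  with kb have "singular_relboundary 1 X {} (frag_of (singular_path g) + frag_of (singular_path ?r))"
    using singular_relboundary_add by fastforce
  from singular_relboundary_diff [OF this rb] show ?thesis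
    by simp
qed

text \<open>The part of the Hurewicz theorem needed here. Each edge is closed up to a loop by chosen
  paths from a base point; these loops bound, and in a cycle the added paths cancel.\<close>

lemma simply_connected_imp_singular_boundary:
  assumes X: "simply_connected_space X" and c: "singular_relcycle 1 X {} c"
  shows "singular_relboundary 1 X {} c"
proof (cases "topspace X = {}")
  case True
  then show ?thesis
    using c by (simp add: singular_cycle singular_chain_empty)
next
  case False
  then obtain x0 where x0: "x0 \<in> topspace X"
    by blast
  have "\<exists>k. pathin X k \<and> k 0 = x0 \<and> k 1 = p" if "p \<in> topspace X" for p
    using X that x0 by (auto simp: simply_connected_space_def path_connected_space_def)
  then obtain k where k: "\<And>p. p \<in> topspace X \<Longrightarrow> pathin X (k p) \<and> k p 0 = x0 \<and> k p 1 = p"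
    by metis
  define K where "K = frag_extend (\<lambda>s. frag_of (singular_path (k (simplex_start s))))"
  have "singular_chain 1 X c"
    using c by (simp add: singular_cycle)
  \<comment> \<open>Claimed for every chain, so that simplices can be treated one at a time: the
    chosen path to the start, continued along the simplex, is homologous to the chosen path to the
    end.\<close>
  then have "singular_relboundary 1 X {} (c - K (chain_boundary 1 c))"
    unfolding singular_chain_def
  proof (induction c rule: frag_induction)
    case zero
    then show ?case
      by (simp add: K_def)
  next
    case (one f)
    then obtain g where g: "pathin X g" "f = singular_path g"
      by (auto elim: singular_simplex_1_path)
    have g01: "g 0 \<in> topspace X" "g 1 \<in> topspace X"
      using g path_start_in_topspace path_finish_in_topspace by auto
    obtain m where m: "pathin X m" "m 0 = x0" "m 1 = g 1"
      and mb: "singular_relboundary 1 X {}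
         (frag_of (singular_path (k (g 0))) + frag_of (singular_path g) - frag_of (singular_path m))"
      using path_join_homologous [of X "k (g 0)" g] k g g01 by metis
    have "singular_relboundary 1 X {} (frag_of (singular_path m) - frag_of (singular_path (k (g 1))))"
      using simply_connected_paths_homologous [OF X, of m "k (g 1)"] k m g01 by simp
    from singular_relboundary_add [OF mb this] show ?case
      by (simp add: K_def g chain_boundary_path frag_extend_diff algebra_simps)
  next
    case (diff a b)
    from singular_relboundary_diff [OF diff] show ?case
      by (simp add: K_def chain_boundary_diff frag_extend_diff algebra_simps)
  qed
  then show ?thesis
    using c by (simp add: singular_cycle K_def)
qed

section \<open>Iterated barycentric subdivision\<close>

lemma singular_chain_iterated_subdivision:
  "singular_chain n X c \<Longrightarrow> singular_chain n X ((singular_subdivision n ^^ m) c)"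
  by (induction m) (auto intro: singular_chain_singular_subdivision)

lemma chain_boundary_iterated_subdivision:
  assumes "singular_chain n X c"
  shows "chain_boundary n ((singular_subdivision n ^^ m) c)
         = (singular_subdivision (n - 1) ^^ m) (chain_boundary n c)"
proof (induction m)
  case (Suc m)
  then show ?case
    using chain_boundary_singular_subdivision [OF singular_chain_iterated_subdivision [OF assms], of m]
    by (simp add: One_nat_def)
qed simp

text \<open>Points are not subdivided. Together with the preceding lemma this shows that subdividing
  a 1-chain does not change its boundary.\<close>

lemma iterated_subdivision_zero:
  assumes "singular_chain 0 X c"
  shows "(singular_subdivision 0 ^^ m) c = c"
  using assms by (induction m) (auto simp: singular_subdivision_zero)

section \<open>Net chains modulo boundaries\<close>

definition net_bounds :: "'k::order set \<Rightarrow> ('k simplex1 \<Rightarrow>\<^sub>0 int) \<Rightarrow> bool" where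
  "net_bounds K z \<longleftrightarrow> z \<in> net_boundary2 ` carrier (free_Abelian_group (net_simplices2 K))"

lemma net_boundary1_simps [simp]:
  "net_boundary1 0 = 0"
  "net_boundary1 (frag_of b) = frag_of (face1_0 b) - frag_of (face1_1 b)"
  "net_boundary1 (x + y) = net_boundary1 x + net_boundary1 y"
  "net_boundary1 (x - y) = net_boundary1 x - net_boundary1 y"
  "net_boundary1 (- x) = - net_boundary1 x"
  by (simp_all add: net_boundary1_def frag_extend_add frag_extend_diff frag_extend_minus)

lemma net_boundary2_simps [simp]:
  "net_boundary2 0 = 0"
  "net_boundary2 (frag_of c) = frag_of (face2_0 c) - frag_of (face2_1 c) + frag_of (face2_2 c)"
  "net_boundary2 (u + v) = net_boundary2 u + net_boundary2 v"
  "net_boundary2 (u - v) = net_boundary2 u - net_boundary2 v"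
  by (simp_all add: net_boundary2_def frag_extend_add frag_extend_diff)

lemma net_bounds_0 [simp]: "net_bounds K 0"
  unfolding net_bounds_def by (rule image_eqI [of _ _ 0]) auto

lemma net_bounds_diff:
  assumes "net_bounds K x" "net_bounds K y"
  shows "net_bounds K (x - y)"
proof -
  obtain u v where uv: "Poly_Mapping.keys u \<subseteq> net_simplices2 K" "Poly_Mapping.keys v \<subseteq> net_simplices2 K"
    "x = net_boundary2 u" "y = net_boundary2 v"
    using assms by (auto simp: net_bounds_def)
  moreover have "Poly_Mapping.keys (u - v) \<subseteq> net_simplices2 K"
    using uv keys_diff [of u v] by blast
  ultimately show ?thesis
    unfolding net_bounds_def by (intro image_eqI [of _ _ "u - v"]) auto
qed

lemma net_bounds_minus: "net_bounds K x \<Longrightarrow> net_bounds K (- x)"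
  using net_bounds_diff [of K 0 x] by simp

lemma net_bounds_add: "net_bounds K x \<Longrightarrow> net_bounds K y \<Longrightarrow> net_bounds K (x + y)"
  using net_bounds_diff [of K x "- y"] net_bounds_minus [of K y] by simp

lemma net_bounds_sym: "net_bounds K (x - y) \<Longrightarrow> net_bounds K (y - x)"
  using net_bounds_minus [of K "x - y"] by simp

lemma net_bounds_trans: "net_bounds K (x - y) \<Longrightarrow> net_bounds K (y - z) \<Longrightarrow> net_bounds K (x - z)"
  using net_bounds_add [of K "x - y" "y - z"] by simp

lemma net_bounds_induct [consumes 1, case_names zero diff simplex]:
  assumes "net_bounds K z"
    and "P 0" and "\<And>x y. P x \<Longrightarrow> P y \<Longrightarrow> P (x - y)"
    and "\<And>c. c \<in> net_simplices2 K \<Longrightarrow> P (frag_of (face2_0 c) - frag_of (face2_1 c) + frag_of (face2_2 c))"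
  shows "P z"
proof -
  obtain u where u: "Poly_Mapping.keys u \<subseteq> net_simplices2 K" "z = net_boundary2 u"
    using assms(1) by (auto simp: net_bounds_def)
  from u(1) have "P (net_boundary2 u)"
    by (induction u rule: frag_induction) (use assms in auto)
  then show ?thesis
    by (simp add: u)
qed

lemma net_bounds_imp_chain: "net_bounds K z \<Longrightarrow> Poly_Mapping.keys z \<subseteq> net_simplices1 K"
proof (induction rule: net_bounds_induct)
  case (diff x y)
  then show ?case
    using keys_diff [of x y] by blast
next
  case (simplex c)
  then show ?case
    using keys_diff [of "frag_of (face2_0 c)" "frag_of (face2_1 c)"]
      keys_add [of "frag_of (face2_0 c) - frag_of (face2_1 c)" "frag_of (face2_2 c)"]
    by (fastforce simp: net_simplices2_def)
qed auto

lemma net_bounds_imp_cycle: "net_bounds K z \<Longrightarrow> net_boundary1 z = 0"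
  by (induction rule: net_bounds_induct) (auto simp: net_simplices2_def)

text \<open>A single 2-simplex with support \<open>W\<close> fills it: its edges run from
  \<open>b\<close> to \<open>a\<close>, from \<open>c\<close> to \<open>a\<close> and from
  \<open>c\<close> to \<open>b\<close>. It is the elementary filling behind the relations between
  links below.\<close>

lemma net_bounds_triangle:
  assumes "W \<in> K" "V0 \<in> K" "V1 \<in> K" "V2 \<in> K" "a \<in> K" "b \<in> K" "c \<in> K"
    and "V0 \<le> W" "V1 \<le> W" "V2 \<le> W"
    and "a \<le> V0" "b \<le> V0" "a \<le> V1" "c \<le> V1" "b \<le> V2" "c \<le> V2"
  shows "net_bounds K (frag_of (Simplex1 V0 a b) - frag_of (Simplex1 V1 a c) + frag_of (Simplex1 V2 b c))"
  unfolding net_bounds_def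
proof (rule image_eqI)
  let ?c = "Simplex2 W (Simplex1 V0 a b) (Simplex1 V1 a c) (Simplex1 V2 b c)"
  show "frag_of (Simplex1 V0 a b) - frag_of (Simplex1 V1 a c) + frag_of (Simplex1 V2 b c)
        = net_boundary2 (frag_of ?c)"
    by simp
  show "frag_of ?c \<in> carrier (free_Abelian_group (net_simplices2 K))"
    using assms by (simp add: net_simplices2_def net_simplices1_def)
qed

text \<open>The edge path that leads from \<open>U\<close> to \<open>V\<close> through a common lower bound \<open>W\<close>.\<close>

definition net_zigzag :: "'k \<Rightarrow> 'k \<Rightarrow> 'k \<Rightarrow> 'k simplex1 \<Rightarrow>\<^sub>0 int" where
  "net_zigzag V U W = frag_of (Simplex1 V V W) - frag_of (Simplex1 U U W)"

lemma net_zigzag_boundary: "net_boundary1 (net_zigzag V U W) = frag_of V - frag_of U"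
  by (simp add: net_zigzag_def)

text \<open>Both legs change by the same edge \<open>Simplex1 W W W'\<close>, which cancels because
  the legs have opposite signs.\<close>

lemma net_zigzag_refine:
  fixes V :: "'k::order"
  assumes "V \<in> K" "U \<in> K" "W \<in> K" "W' \<in> K" "W' \<le> W" "W \<le> V" "W \<le> U"
  shows "net_bounds K (net_zigzag V U W' - net_zigzag V U W)"
proof -
  have le: "W' \<le> V" "W' \<le> U"
    using assms by auto
  have "net_bounds K (frag_of (Simplex1 V V W) - frag_of (Simplex1 V V W') + frag_of (Simplex1 W W W'))"
    "net_bounds K (frag_of (Simplex1 U U W) - frag_of (Simplex1 U U W') + frag_of (Simplex1 W W W'))"
    using assms le by (auto intro: net_bounds_triangle [of V] net_bounds_triangle [of U])
  from net_bounds_diff [OF this(2,1)] show ?thesis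
    by (simp add: net_zigzag_def algebra_simps)
qed

text \<open>The leg from \<open>W\<close> to \<open>V\<close> factors through \<open>V'\<close>, and
  the leg to \<open>U\<close> is untouched. The resulting correction does not involve
  \<open>W\<close>; this is what later makes it independent of the point.\<close>

lemma net_zigzag_mono:
  fixes V :: "'k::order"
  assumes "V \<in> K" "V' \<in> K" "W \<in> K" "V' \<le> V" "W \<le> V'"
  shows "net_bounds K (net_zigzag V U W - net_zigzag V' U W - frag_of (Simplex1 V V V'))"
proof -
  have "W \<le> V"
    using assms by auto
  then have "net_bounds K (frag_of (Simplex1 V V V') - frag_of (Simplex1 V V W) + frag_of (Simplex1 V' V' W))"
    using assms by (auto intro!: net_bounds_triangle [of V])
  from net_bounds_minus [OF this] show ?thesis
    by (simp add: net_zigzag_def algebra_simps)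
qed

lemma hom_net_boundary1:
  "net_boundary1 \<in> hom (free_Abelian_group (net_simplices1 K)) (free_Abelian_group K)"
proof (rule homI)
  fix z assume "z \<in> carrier (free_Abelian_group (net_simplices1 K))"
  then have "Poly_Mapping.keys z \<subseteq> net_simplices1 K"
    by simp
  then show "net_boundary1 z \<in> carrier (free_Abelian_group K)"
  proof (induction z rule: frag_induction)
    case (one b)
    then show ?case
      using keys_diff [of "frag_of (face1_0 b)" "frag_of (face1_1 b)"] by (auto simp: net_simplices1_def)
  next
    case (diff x y)
    then show ?case
      using keys_diff [of "net_boundary1 x" "net_boundary1 y"] by auto
  qed auto
qed auto

lemma subgroup_net_bounds:
  "subgroup (Collect (net_bounds K)) (free_Abelian_group (net_simplices1 K))"
proof (rule group.subgroupI)
  show "Collect (net_bounds K) \<noteq> {}"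
    using net_bounds_0 by blast
qed (auto simp: net_bounds_imp_chain net_bounds_add net_bounds_minus dest: net_bounds_imp_chain)

lemma net_bounds_subset_kernel:
  "Collect (net_bounds K)
   \<subseteq> kernel (free_Abelian_group (net_simplices1 K)) (free_Abelian_group K) net_boundary1"
  using net_bounds_imp_chain net_bounds_imp_cycle by (auto simp: kernel_def)

lemma net_homology1_alt:
  "net_homology1 K =
     subgroup_generated (free_Abelian_group (net_simplices1 K))
       (kernel (free_Abelian_group (net_simplices1 K)) (free_Abelian_group K) net_boundary1)
     Mod Collect (net_bounds K)"
proof -
  have "net_boundary2 ` carrier (free_Abelian_group (net_simplices2 K)) = Collect (net_bounds K)"
    by (auto simp: net_bounds_def)
  then show ?thesis
    by (simp add: net_homology1_def)
qed

lemma subgroup_net_cycles: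
  "subgroup (kernel (free_Abelian_group (net_simplices1 K)) (free_Abelian_group K) net_boundary1)
     (free_Abelian_group (net_simplices1 K))"
  using hom_net_boundary1
  by (intro group_hom.subgroup_kernel) (simp add: group_hom_def group_hom_axioms_def)

lemma normal_net_bounds:
  "Collect (net_bounds K) \<lhd> subgroup_generated (free_Abelian_group (net_simplices1 K))
     (kernel (free_Abelian_group (net_simplices1 K)) (free_Abelian_group K) net_boundary1)"
  (is "_ \<lhd> ?Z")
proof -
  have "comm_group ?Z"
    by (simp add: abelian_free_Abelian_group group.abelian_subgroup_generated)
  moreover have "subgroup (Collect (net_bounds K)) ?Z"
    by (simp add: group.subgroup_of_subgroup_generated net_bounds_subset_kernel subgroup_net_bounds)
  ultimately show ?thesis
    by (simp add: comm_group.normal_iff_subgroup)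
qed

lemma group_net_homology1: "group (net_homology1 K)"
  unfolding net_homology1_alt by (rule normal.factorgroup_is_group [OF normal_net_bounds])

section \<open>Net homology and singular homology\<close>

locale simply_connected_base =
  fixes M :: "'m topology" and B :: "'m set set"
  assumes base: "openin M = arbitrary union_of (\<lambda>U. U \<in> B)"
    and base_nonempty: "U \<in> B \<Longrightarrow> U \<noteq> {}"
    and base_simply_connected: "U \<in> B \<Longrightarrow> simply_connectedin M U"
begin

lemma base_open: "U \<in> B \<Longrightarrow> openin M U"
  by (simp add: base arbitrary_union_of_inc)

lemma base_subset: "U \<in> B \<Longrightarrow> U \<subseteq> topspace M"
  by (simp add: base_open openin_subset)

lemma base_refine:
  assumes "openin M S" "p \<in> S"
  obtains U where "U \<in> B" "p \<in> U" "U \<subseteq> S"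
  using assms unfolding base union_of_def by blast

lemma base_Union: "topspace M \<subseteq> \<Union>B"
  by (meson UnionI base_refine openin_topspace subsetI)

section \<open>Linking a member of the base to the chosen neighbourhood of a point\<close>

definition cover :: "'m \<Rightarrow> 'm set" where
  "cover p = (SOME U. U \<in> B \<and> p \<in> U)"

lemma cover: assumes "p \<in> topspace M" shows "cover p \<in> B" "p \<in> cover p"
proof -
  have "\<exists>U. U \<in> B \<and> p \<in> U"
    using assms base_Union by blast
  then have "cover p \<in> B \<and> p \<in> cover p"
    unfolding cover_def by (rule someI_ex)
  then show "cover p \<in> B" "p \<in> cover p"
    by auto
qed

text \<open>The intersection is open but need not be a member of the base, so a smaller member
  around \<open>p\<close> is chosen.\<close>

definition lower :: "'m set \<Rightarrow> 'm \<Rightarrow> 'm set" where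
  "lower V p = (SOME W. W \<in> B \<and> p \<in> W \<and> W \<subseteq> V \<inter> cover p)"

lemma lower:
  assumes "V \<in> B" "p \<in> V"
  shows "lower V p \<in> B" "p \<in> lower V p" "lower V p \<subseteq> V" "lower V p \<subseteq> cover p"
proof -
  have p: "p \<in> topspace M"
    using assms base_subset by blast
  then have "\<exists>W. W \<in> B \<and> p \<in> W \<and> W \<subseteq> V \<inter> cover p"
    using base_refine [of "V \<inter> cover p" p] assms cover [OF p] base_open by blast
  then have "lower V p \<in> B \<and> p \<in> lower V p \<and> lower V p \<subseteq> V \<inter> cover p"
    unfolding lower_def by (rule someI_ex)
  then show "lower V p \<in> B" "p \<in> lower V p" "lower V p \<subseteq> V" "lower V p \<subseteq> cover p"
    by auto
qed

definition link :: "'m set \<Rightarrow> 'm \<Rightarrow> 'm set simplex1 \<Rightarrow>\<^sub>0 int" where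
  "link V p = net_zigzag V (cover p) (lower V p)"

lemma link_boundary: "net_boundary1 (link V p) = frag_of V - frag_of (cover p)"
  by (simp add: link_def net_zigzag_boundary)

lemma link_chain:
  assumes "V \<in> B" "p \<in> V"
  shows "Poly_Mapping.keys (link V p) \<subseteq> net_simplices1 B"
proof -
  have "p \<in> topspace M"
    using assms base_subset by blast
  then have "Simplex1 V V (lower V p) \<in> net_simplices1 B"
    "Simplex1 (cover p) (cover p) (lower V p) \<in> net_simplices1 B"
    using assms lower [OF assms] cover by (auto simp: net_simplices1_def)
  then show ?thesis
    unfolding link_def net_zigzag_def
    using keys_diff [of "frag_of (Simplex1 V V (lower V p))"] by fastforce
qed

text \<open>\<open>W\<close> and \<open>lower V p\<close> are compared through a member of the base
  around \<open>p\<close> inside both.\<close>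

lemma link_zigzag:
  assumes V: "V \<in> B" "p \<in> V" and W: "W \<in> B" "p \<in> W" "W \<subseteq> V" "W \<subseteq> cover p"
  shows "net_bounds B (link V p - net_zigzag V (cover p) W)"
proof -
  have p: "cover p \<in> B"
    using V base_subset cover by blast
  have "openin M (lower V p \<inter> W)"
    using lower [OF V] W base_open by (intro openin_Int) auto
  then obtain W' where W': "W' \<in> B" "p \<in> W'" "W' \<subseteq> lower V p \<inter> W"
    using base_refine [of "lower V p \<inter> W" p] lower [OF V] W by (metis IntI)
  have "net_bounds B (net_zigzag V (cover p) W' - link V p)"
    unfolding link_def using V W' p lower [OF V] by (intro net_zigzag_refine) auto
  moreover have "net_bounds B (net_zigzag V (cover p) W' - net_zigzag V (cover p) W)"
    using V W' W p by (intro net_zigzag_refine) auto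
  ultimately show ?thesis
    by (meson net_bounds_sym net_bounds_trans)
qed

text \<open>\<open>lower V' p\<close> also lies in \<open>V\<close>, so both links may be taken
  through it. They then differ by the edge from \<open>V'\<close> to \<open>V\<close>, in which
  \<open>p\<close> does not occur.\<close>

lemma link_mono:
  assumes V: "V \<in> B" and V': "V' \<in> B" "V' \<subseteq> V" "p \<in> V'"
  shows "net_bounds B (link V p - link V' p - frag_of (Simplex1 V V V'))"
proof -
  note m = lower [OF V'(1,3)]
  have "net_bounds B (link V p - net_zigzag V (cover p) (lower V' p))"
    using V V' m by (intro link_zigzag) auto
  moreover have "net_bounds B (net_zigzag V (cover p) (lower V' p) - link V' p - frag_of (Simplex1 V V V'))"
    unfolding link_def using V V' m by (intro net_zigzag_mono) auto
  ultimately have "net_bounds B ((link V p - net_zigzag V (cover p) (lower V' p))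
      + (net_zigzag V (cover p) (lower V' p) - link V' p - frag_of (Simplex1 V V V')))"
    by (rule net_bounds_add)
  then show ?thesis
    by (simp add: algebra_simps)
qed

text \<open>\<open>link V p - link W p\<close> is locally constant in \<open>p\<close>, hence constant along every path.\<close>

lemma link_diff_path:
  assumes g: "pathin M g" and gVW: "g \<in> {0..1} \<rightarrow> V \<inter> W" and V: "V \<in> B" and W: "W \<in> B"
  shows "net_bounds B ((link V (g 0) - link V (g 1)) - (link W (g 0) - link W (g 1)))"
proof -
  define D where "D = (\<lambda>t. link V (g t) - link W (g t))"
  have "net_bounds B (D 0 - D 1)"
  proof (rule connected_equivalence_relation [where S = "{0..1::real}" and R = "\<lambda>s t. net_bounds B (D s - D t)"])
    fix a :: real assume a: "a \<in> {0..1}"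
    then obtain N where N: "N \<in> B" "g a \<in> N" "N \<subseteq> V \<inter> W"
      using base_refine [of "V \<inter> W" "g a"] gVW V W base_open by (metis PiE openin_Int)
    define T where "T = {t \<in> topspace (top_of_set {0..1}). g t \<in> N}"
    have "openin (top_of_set {0..1}) T"
      unfolding T_def using g base_open [OF N(1)]
      by (intro openin_continuous_map_preimage) (auto simp: pathin_def)
    moreover have "a \<in> T"
      using a N by (simp add: T_def)
    moreover have "net_bounds B (D a - D t)" if t: "t \<in> T" for t
    proof -
      \<comment> \<open>As long as \<open>g\<close> stays in \<open>N\<close>, both links can be
        compared with the link of \<open>N\<close>. Modulo boundaries \<open>D\<close> is then this
        chain, from which the point has disappeared.\<close>
      let ?k = "frag_of (Simplex1 V V N) - frag_of (Simplex1 W W N)"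
      have D: "net_bounds B (D s - ?k)" if "g s \<in> N" for s
      proof -
        have "net_bounds B (link V (g s) - link N (g s) - frag_of (Simplex1 V V N))"
          "net_bounds B (link W (g s) - link N (g s) - frag_of (Simplex1 W W N))"
          using that N V W by (auto intro!: link_mono)
        from net_bounds_diff [OF this] show ?thesis
          by (simp add: D_def algebra_simps)
      qed
      show ?thesis
        using D [of a] D [of t] N t by (auto simp: T_def intro: net_bounds_trans net_bounds_sym)
    qed
    ultimately show "\<exists>T. openin (top_of_set {0..1}) T \<and> a \<in> T \<and> (\<forall>x\<in>T. net_bounds B (D a - D x))"
      by blast
  qed (auto intro: net_bounds_sym net_bounds_trans)
  then show ?thesis
    by (simp add: D_def algebra_simps)
qed

section \<open>The net chain traced out by a small singular chain\<close>

definition small_simplices :: "nat \<Rightarrow> ((nat \<Rightarrow> real) \<Rightarrow> 'm) set" where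
  "small_simplices n = {f. \<exists>V\<in>B. singular_simplex n (subtopology M V) f}"

lemma small_simplices_singular: "f \<in> small_simplices n \<Longrightarrow> singular_simplex n M f"
  by (auto simp: small_simplices_def singular_simplex_subtopology)

definition carrier_of :: "((nat \<Rightarrow> real) \<Rightarrow> 'm) \<Rightarrow> 'm set" where
  "carrier_of f = (SOME V. V \<in> B \<and> singular_simplex 1 (subtopology M V) f)"

lemma carrier_of:
  assumes "f \<in> small_simplices 1"
  shows "carrier_of f \<in> B" "singular_simplex 1 (subtopology M (carrier_of f)) f"
proof -
  have "\<exists>V. V \<in> B \<and> singular_simplex 1 (subtopology M V) f"
    using assms by (auto simp: small_simplices_def)
  then have "carrier_of f \<in> B \<and> singular_simplex 1 (subtopology M (carrier_of f)) f"
    unfolding carrier_of_def by (rule someI_ex)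
  then show "carrier_of f \<in> B" "singular_simplex 1 (subtopology M (carrier_of f)) f"
    by auto
qed

text \<open>Since \<open>link V p\<close> runs from \<open>cover p\<close> to \<open>V\<close>, this
  edge path leads from the cover of the start through the carrier to the cover of the end. Covers
  depend on the point alone, so traces of consecutive simplices fit together.\<close>

definition trace :: "((nat \<Rightarrow> real) \<Rightarrow> 'm) \<Rightarrow> 'm set simplex1 \<Rightarrow>\<^sub>0 int" where
  "trace f = link (carrier_of f) (simplex_start f) - link (carrier_of f) (simplex_end f)"

lemma simplex_ends_in_base:
  assumes "V \<in> B" "singular_simplex 1 (subtopology M V) f"
  shows "simplex_start f \<in> V" "simplex_end f \<in> V"
  using simplex_ends_in_topspace [OF assms(2)] by auto

lemma trace_chain:
  assumes f: "f \<in> small_simplices 1"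
  shows "Poly_Mapping.keys (trace f) \<subseteq> net_simplices1 B"
  using carrier_of [OF f] simplex_ends_in_base [OF carrier_of [OF f]] link_chain
    keys_diff [of "link (carrier_of f) (simplex_start f)" "link (carrier_of f) (simplex_end f)"]
  unfolding trace_def by blast

text \<open>The path underlying \<open>f\<close> runs inside both \<open>V\<close> and
  \<open>carrier_of f\<close>, and along it the difference of the two links is constant modulo
  boundaries. So the choice of the carrier does not matter.\<close>

lemma trace_local:
  assumes V: "V \<in> B" and f: "singular_simplex 1 (subtopology M V) f"
  shows "net_bounds B (trace f - (link V (simplex_start f) - link V (simplex_end f)))"
proof -
  let ?W = "carrier_of f"
  have small: "f \<in> small_simplices 1"
    using assms by (auto simp: small_simplices_def)
  note W = carrier_of [OF small]
  obtain g where g: "pathin M g" "f = singular_path g" "g \<in> {0..1} \<rightarrow> f ` standard_simplex 1"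
    using singular_simplex_1_path [OF small_simplices_singular [OF small]] by blast
  have "f ` standard_simplex 1 \<subseteq> ?W \<inter> V"
    using f W by (auto simp: singular_simplex_subtopology)
  then have "g \<in> {0..1} \<rightarrow> ?W \<inter> V"
    using g(3) by blast
  from link_diff_path [OF g(1) this W(1) V] show ?thesis
    by (simp add: trace_def g(2))
qed

definition trace_chain_map :: "'m chain \<Rightarrow> 'm set simplex1 \<Rightarrow>\<^sub>0 int" where
  "trace_chain_map = frag_extend trace"

lemma trace_chain_map_chain:
  "Poly_Mapping.keys c \<subseteq> small_simplices 1 \<Longrightarrow> Poly_Mapping.keys (trace_chain_map c) \<subseteq> net_simplices1 B"
  unfolding trace_chain_map_def using trace_chain keys_frag_extend [of trace c] by blast

definition cover_chain :: "'m chain \<Rightarrow> 'm set \<Rightarrow>\<^sub>0 int" where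
  "cover_chain = frag_extend (\<lambda>s. frag_of (cover (simplex_start s)))"

text \<open>The vertex \<open>carrier_of f\<close> occurs with both signs and cancels, which leaves
  the covers of the end points.\<close>

lemma trace_chain_map_boundary:
  "net_boundary1 (trace_chain_map c) = cover_chain (chain_boundary 1 c)"
  using subset_UNIV
proof (induction c rule: frag_induction)
  case (one f)
  then show ?case
    by (simp add: trace_chain_map_def trace_def link_boundary cover_chain_def chain_boundary_1 frag_extend_diff)
qed (auto simp: trace_chain_map_def cover_chain_def frag_extend_diff chain_boundary_diff)

text \<open>All traces may be computed with the one carrier \<open>V\<close>, and then the sum
  telescopes to a function of the boundary. In particular a cycle inside \<open>V\<close> has a
  bounding trace.\<close>

lemma trace_chain_map_local:
  assumes V: "V \<in> B" and c: "singular_chain 1 (subtopology M V) c"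
  shows "net_bounds B (trace_chain_map c + frag_extend (\<lambda>s. link V (simplex_start s)) (chain_boundary 1 c))"
  using c unfolding singular_chain_def
proof (induction c rule: frag_induction)
  case (one f)
  then show ?case
    using trace_local [OF V, of f]
    by (simp add: trace_chain_map_def chain_boundary_1 frag_extend_diff algebra_simps)
next
  case (diff a b)
  from net_bounds_diff [OF diff] show ?case
    by (simp add: trace_chain_map_def frag_extend_diff chain_boundary_diff algebra_simps)
qed (auto simp: trace_chain_map_def)

text \<open>The boundary of a small 2-simplex is a cycle inside a single member of the base, so its
  trace bounds.\<close>

lemma trace_small_boundary:
  assumes "Poly_Mapping.keys d \<subseteq> small_simplices 2"
  shows "net_bounds B (trace_chain_map (chain_boundary 2 d))"
  using assms
proof (induction d rule: frag_induction)
  case (one f)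
  then obtain V where V: "V \<in> B" "singular_simplex 2 (subtopology M V) f"
    by (auto simp: small_simplices_def)
  then have f: "singular_chain 2 (subtopology M V) (frag_of f)"
    by (simp add: singular_chain_of)
  have "singular_chain 1 (subtopology M V) (chain_boundary 2 (frag_of f))"
    using singular_chain_boundary [OF f] by simp
  moreover have "chain_boundary 1 (chain_boundary 2 (frag_of f)) = 0"
    using chain_boundary_boundary [OF f] by simp
  ultimately show ?case
    using trace_chain_map_local [OF V(1)] by fastforce
qed (auto simp: trace_chain_map_def frag_extend_diff chain_boundary_diff net_bounds_diff)

lemma subdivision_small:
  assumes "singular_chain n M c"
  obtains m where "Poly_Mapping.keys ((singular_subdivision n ^^ m) c) \<subseteq> small_simplices n"
proof -
  obtain m where m: "\<And>k f. \<lbrakk>m \<le> k; f \<in> Poly_Mapping.keys ((singular_subdivision n ^^ k) c)\<rbrakk>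
        \<Longrightarrow> \<exists>V\<in>B. f \<in> standard_simplex n \<rightarrow> V"
    using sufficient_iterated_singular_subdivision_exists [of B M n c] base_open base_Union assms by metis
  have "f \<in> small_simplices n" if f: "f \<in> Poly_Mapping.keys ((singular_subdivision n ^^ m) c)" for f
  proof -
    have "singular_simplex n M f"
      using singular_chain_iterated_subdivision [OF assms, of m] f by (auto simp: singular_chain_def)
    then show ?thesis
      using m [OF order_refl f] by (auto simp: small_simplices_def singular_simplex_subtopology)
  qed
  then show ?thesis
    using that by blast
qed

section \<open>Realizing net chains by paths in the space\<close>

definition base_point :: "'m set \<Rightarrow> 'm" where
  "base_point U = (SOME x. x \<in> U)"

lemma base_point: "U \<in> B \<Longrightarrow> base_point U \<in> U"
  unfolding base_point_def by (rule someI_ex) (use base_nonempty in blast)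

lemma base_point_subset: "U \<in> B \<Longrightarrow> U \<subseteq> V \<Longrightarrow> base_point U \<in> V"
  using base_point by blast

definition segment :: "'m set \<Rightarrow> 'm \<Rightarrow> 'm \<Rightarrow> 'm chain" where
  "segment U p q = frag_of (singular_path
     (SOME g. pathin (subtopology M U) g \<and> g 0 = p \<and> g 1 = q))"

lemma segment:
  assumes "U \<in> B" "p \<in> U" "q \<in> U"
  shows "singular_chain 1 (subtopology M U) (segment U p q)"
    "chain_boundary 1 (segment U p q) = frag_of (singular_point q) - frag_of (singular_point p)"
proof -
  have "path_connected_space (subtopology M U)" "topspace (subtopology M U) = U"
    using base_simply_connected [OF assms(1)] base_subset [OF assms(1)]
    by (auto simp: simply_connectedin_def simply_connected_space_def)
  then have "\<exists>g. pathin (subtopology M U) g \<and> g 0 = p \<and> g 1 = q"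
    using assms unfolding path_connected_space_def by blast
  from someI_ex [OF this]
  show "singular_chain 1 (subtopology M U) (segment U p q)"
    "chain_boundary 1 (segment U p q) = frag_of (singular_point q) - frag_of (singular_point p)"
    unfolding segment_def by (auto simp: chain_boundary_path intro: singular_chain_path)
qed

text \<open>The first homology of \<open>V\<close> vanishes by simple connectedness, and a filling
  inside \<open>V\<close> is also one in \<open>M\<close>.\<close>

lemma local_cycle_bounds:
  assumes V: "V \<in> B" and c: "singular_chain 1 (subtopology M V) c" "chain_boundary 1 c = 0"
  shows "singular_relboundary 1 M {} c"
proof -
  have "singular_relboundary 1 (subtopology M V) {} c"
    using base_simply_connected [OF V] c
    by (intro simply_connected_imp_singular_boundary) (auto simp: simply_connectedin_def singular_cycle)
  then show ?thesis
    using singular_boundary_mono [OF base_subset [OF V], of 1 M c] by simp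
qed

definition realize :: "'m set simplex1 \<Rightarrow> 'm chain" where
  "realize b = segment (supp1 b) (base_point (face1_1 b)) (base_point (face1_0 b))"

lemma realize:
  assumes "b \<in> net_simplices1 B"
  shows "singular_chain 1 (subtopology M (supp1 b)) (realize b)"
    "chain_boundary 1 (realize b) = frag_of (singular_point (base_point (face1_0 b)))
       - frag_of (singular_point (base_point (face1_1 b)))"
  using assms unfolding realize_def net_simplices1_def
  by (auto intro!: segment base_point_subset)

definition realize_chain :: "('m set simplex1 \<Rightarrow>\<^sub>0 int) \<Rightarrow> 'm chain" where
  "realize_chain = frag_extend realize"

lemma realize_chain_simps [simp]:
  "realize_chain 0 = 0" "realize_chain (frag_of b) = realize b"
  "realize_chain (x + y) = realize_chain x + realize_chain y"
  "realize_chain (x - y) = realize_chain x - realize_chain y"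
  by (simp_all add: realize_chain_def frag_extend_add frag_extend_diff)

lemma realize_chain_boundary:
  assumes "Poly_Mapping.keys z \<subseteq> net_simplices1 B"
  shows "chain_boundary 1 (realize_chain z)
         = frag_extend (\<lambda>U. frag_of (singular_point (base_point U))) (net_boundary1 z)"
  using assms
  by (induction z rule: frag_induction) (auto simp: realize frag_extend_diff chain_boundary_diff)

lemma realize_chain_local:
  assumes "Poly_Mapping.keys z \<subseteq> net_simplices1 B" "\<And>b. b \<in> Poly_Mapping.keys z \<Longrightarrow> supp1 b \<subseteq> V"
  shows "singular_chain 1 (subtopology M V) (realize_chain z)"
  unfolding realize_chain_def
  by (intro singular_chain_extend singular_chain_mono [OF realize(1)]) (use assms in auto)

lemma realize_chain_singular:
  assumes "Poly_Mapping.keys z \<subseteq> net_simplices1 B"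
  shows "singular_chain 1 M (realize_chain z)"
  using realize_chain_local [OF assms, of "topspace M"] assms base_subset
  by (force simp: net_simplices1_def)

lemma realize_chain_bounds:
  assumes "net_bounds B z"
  shows "singular_relboundary 1 M {} (realize_chain z)"
  using assms
proof (induction rule: net_bounds_induct)
  case (diff x y)
  then show ?case
    by (simp add: singular_relboundary_diff)
next
  case (simplex c)
  let ?z = "frag_of (face2_0 c) - frag_of (face2_1 c) + frag_of (face2_2 c)"
  have c: "supp2 c \<in> B" "face2_0 c \<in> net_simplices1 B" "face2_1 c \<in> net_simplices1 B" "face2_2 c \<in> net_simplices1 B"
    "supp1 (face2_0 c) \<subseteq> supp2 c" "supp1 (face2_1 c) \<subseteq> supp2 c" "supp1 (face2_2 c) \<subseteq> supp2 c"
    "net_boundary1 ?z = 0"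
    using simplex by (auto simp: net_simplices2_def)
  have keys: "Poly_Mapping.keys ?z \<subseteq> {face2_0 c, face2_1 c, face2_2 c}"
    using keys_diff [of "frag_of (face2_0 c)" "frag_of (face2_1 c)"]
      keys_add [of "frag_of (face2_0 c) - frag_of (face2_1 c)" "frag_of (face2_2 c)"] by auto
  have zB: "Poly_Mapping.keys ?z \<subseteq> net_simplices1 B"
    using keys c by blast
  \<comment> \<open>The three edges are realized inside the support of the 2-simplex, where their
    closed path can be filled.\<close>
  have "singular_chain 1 (subtopology M (supp2 c)) (realize_chain ?z)"
    using keys c by (intro realize_chain_local zB) blast
  moreover have "chain_boundary 1 (realize_chain ?z) = 0"
    using realize_chain_boundary [OF zB] c(8) by simp
  ultimately show ?case
    by (rule local_cycle_bounds [OF c(1)])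
qed simp

text \<open>The map sending \<open>U\<close> to \<open>link U (base_point U)\<close> is the degree-0
  part of a chain homotopy to the identity, and its contribution vanishes on cycles. A realized edge
  stays in its support under any number of subdivisions, so \<open>m\<close> is arbitrary; it will
  be dictated by a 2-chain to be made small.\<close>

lemma trace_realize:
  assumes "Poly_Mapping.keys z \<subseteq> net_simplices1 B"
  shows "net_bounds B (trace_chain_map ((singular_subdivision 1 ^^ m) (realize_chain z)) - z
           + frag_extend (\<lambda>U. link U (base_point U)) (net_boundary1 z))"
  using assms
proof (induction z rule: frag_induction)
  case zero
  then show ?case
    by (simp add: trace_chain_map_def)
next
  case (one b)
  obtain V U0 U1 where b: "b = Simplex1 V U0 U1"
    by (cases b)
  have B: "V \<in> B" "U0 \<in> B" "U1 \<in> B" "U0 \<subseteq> V" "U1 \<subseteq> V"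
    using one by (auto simp: b net_simplices1_def)
  let ?x0 = "base_point U0" and ?x1 = "base_point U1"
  let ?c = "(singular_subdivision 1 ^^ m) (realize b)"
  have r: "singular_chain 1 (subtopology M V) (realize b)"
    and br: "chain_boundary 1 (realize b) = frag_of (singular_point ?x0) - frag_of (singular_point ?x1)"
    using realize [OF one] by (auto simp: b)
  have "singular_chain 0 (subtopology M V) (chain_boundary 1 (realize b))"
    using singular_chain_boundary [OF r] by (simp add: One_nat_def)
  then have bc: "chain_boundary 1 ?c = frag_of (singular_point ?x0) - frag_of (singular_point ?x1)"
    using chain_boundary_iterated_subdivision [OF r] iterated_subdivision_zero br by simp
  have "singular_chain 1 (subtopology M V) ?c"
    using r by (rule singular_chain_iterated_subdivision)
  from trace_chain_map_local [OF B(1) this]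
  have 1: "net_bounds B (trace_chain_map ?c + (link V ?x0 - link V ?x1))"
    by (simp add: bc frag_extend_diff)
  have 2: "net_bounds B (link V ?x0 - link U0 ?x0 - frag_of (Simplex1 V V U0))"
    and 3: "net_bounds B (link V ?x1 - link U1 ?x1 - frag_of (Simplex1 V V U1))"
    using B base_point by (auto intro!: link_mono)
  have 4: "net_bounds B (frag_of (Simplex1 V V U0) - frag_of (Simplex1 V V U1) + frag_of b)"
    unfolding b using B by (intro net_bounds_triangle [of V]) auto
  \<comment> \<open>In the combination 1 - 2 + 3 - 4 the links to \<open>V\<close> and the edges
    into \<open>V\<close> cancel; 4 is the triangle on \<open>V\<close>, \<open>U0\<close>,
    \<open>U1\<close>.\<close>
  from net_bounds_diff [OF net_bounds_add [OF net_bounds_diff [OF 1 2] 3] 4]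
  show ?case
    by (simp add: b frag_extend_diff algebra_simps)
next
  case (diff x y)
  from net_bounds_diff [OF diff] show ?case
    by (simp add: trace_chain_map_def frag_extend_diff singular_subdivision_power_diff algebra_simps)
qed

text \<open>A filling of the realized cycle becomes small after subdivision, and its trace shows
  that the subdivided realization has a bounding trace. By \<open>trace_realize\<close> that trace
  is homologous to \<open>z\<close>.\<close>

lemma realize_chain_injective:
  assumes z: "Poly_Mapping.keys z \<subseteq> net_simplices1 B" "net_boundary1 z = 0"
    and bd: "singular_relboundary 1 M {} (realize_chain z)"
  shows "net_bounds B z"
proof -
  obtain d where d: "singular_chain 2 M d" "chain_boundary 2 d = realize_chain z"
    using bd by (auto simp: singular_boundary numeral_2_eq_2 One_nat_def)
  obtain m where m: "Poly_Mapping.keys ((singular_subdivision 2 ^^ m) d) \<subseteq> small_simplices 2"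
    by (rule subdivision_small [OF d(1)])
  have "net_bounds B (trace_chain_map ((singular_subdivision 1 ^^ m) (realize_chain z)))"
    using trace_small_boundary [OF m] chain_boundary_iterated_subdivision [OF d(1), of m] d(2)
    by (simp add: One_nat_def)
  from net_bounds_diff [OF this trace_realize [OF z(1), of m]] show ?thesis
    by (simp add: z(2))
qed

text \<open>Joining \<open>p\<close> to the two end points of the realized link gives a closed path.
  The segment from \<open>p\<close> to the base point of \<open>lower V p\<close> cuts it into one
  triangle inside \<open>V\<close> and one inside \<open>cover p\<close>.\<close>

lemma realize_link:
  assumes V: "V \<in> B" "p \<in> V"
  shows "singular_relboundary 1 M {} (realize_chain (link V p) - segment V p (base_point V)
           + segment (cover p) p (base_point (cover p)))"
proof -
  let ?W = "lower V p"
  have pM: "p \<in> topspace M"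
    using assms base_subset by blast
  note W = lower [OF V]
  \<comment> \<open>The triangle on \<open>p\<close> and the base points of \<open>?W\<close> and
    \<open>U\<close>. Its edge inside \<open>?W\<close> does not depend on \<open>U\<close> and
    drops out of the difference for \<open>V\<close> and \<open>cover p\<close>.\<close>
  have *: "singular_relboundary 1 M {} (segment U (base_point ?W) (base_point U)
      + segment ?W p (base_point ?W) - segment U p (base_point U))"
    if U: "U \<in> B" "?W \<subseteq> U" for U
  proof (rule local_cycle_bounds [OF U(1)])
    have p: "p \<in> U" "base_point ?W \<in> U"
      using U W base_point by auto
    have "singular_chain 1 (subtopology M U) (segment ?W p (base_point ?W))"
      using U W base_point by (auto intro: singular_chain_mono [OF segment(1)])
    then show "singular_chain 1 (subtopology M U) (segment U (base_point ?W) (base_point U)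
      + segment ?W p (base_point ?W) - segment U p (base_point U))"
      using U p base_point by (intro singular_chain_add singular_chain_diff segment) auto
    show "chain_boundary 1 (segment U (base_point ?W) (base_point U)
      + segment ?W p (base_point ?W) - segment U p (base_point U)) = 0"
      using U p W base_point by (simp add: chain_boundary_add chain_boundary_diff segment)
  qed
  from singular_relboundary_diff [OF * [OF V(1)] * [of "cover p"]] show ?thesis
    using W cover [OF pM] by (simp add: link_def net_zigzag_def realize_def algebra_simps)
qed

text \<open>The homotopy for the other composite moves a point along a segment to the base point of
  its cover. Each simplex is replaced inside its carrier by two segments through the base point, to
  which \<open>realize_link\<close> applies.\<close>

lemma realize_trace:
  assumes "Poly_Mapping.keys c \<subseteq> small_simplices 1"
  shows "singular_relboundary 1 M {} (c - realize_chain (trace_chain_map c)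
     + frag_extend (\<lambda>s. segment (cover (simplex_start s)) (simplex_start s) (base_point (cover (simplex_start s))))
         (chain_boundary 1 c))"
  using assms
proof (induction c rule: frag_induction)
  case zero
  then show ?case
    by (simp add: trace_chain_map_def)
next
  case (one f)
  let ?V = "carrier_of f" and ?p = "simplex_start f" and ?q = "simplex_end f"
  note V = carrier_of [OF one]
  note pq = simplex_ends_in_base [OF V]
  note seg = segment [OF V(1) pq(1) base_point [OF V(1)]] segment [OF V(1) pq(2) base_point [OF V(1)]]
  \<comment> \<open>The triangle formed by \<open>f\<close> and the base point of its
    carrier.\<close>
  have 1: "singular_relboundary 1 M {} (frag_of f + segment ?V ?q (base_point ?V) - segment ?V ?p (base_point ?V))"
    using V seg
    by (intro local_cycle_bounds [OF V(1)])
      (simp_all add: singular_chain_add singular_chain_diff singular_chain_of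
        chain_boundary_add chain_boundary_diff chain_boundary_1)
  from singular_relboundary_add [OF singular_relboundary_diff
      [OF 1 realize_link [OF V(1) pq(1)]] realize_link [OF V(1) pq(2)]]
  show ?case
    by (simp add: trace_chain_map_def trace_def chain_boundary_1 frag_extend_diff algebra_simps)
next
  case (diff x y)
  from singular_relboundary_diff [OF diff] show ?case
    by (simp add: trace_chain_map_def frag_extend_diff chain_boundary_diff algebra_simps)
qed

text \<open>Every homology class has a small representative, and on a cycle the error term of
  \<open>realize_trace\<close> is zero; so the trace of that representative is the required net
  cycle.\<close>

lemma realize_chain_surjective:
  assumes c: "singular_relcycle 1 M {} c"
  obtains z where "Poly_Mapping.keys z \<subseteq> net_simplices1 B" "net_boundary1 z = 0"
    "singular_relboundary 1 M {} (c - realize_chain z)"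
proof -
  obtain c' where c': "singular_relcycle 1 M {} c'" "homologous_rel 1 M {} c c'"
    and c'B: "\<And>f. f \<in> Poly_Mapping.keys c' \<Longrightarrow> \<exists>V\<in>B. f \<in> standard_simplex 1 \<rightarrow> V"
    using small_homologous_rel_relcycle_exists [of B M 1 "{}" c] base_open base_Union c by metis
  have small: "Poly_Mapping.keys c' \<subseteq> small_simplices 1"
  proof
    fix f assume f: "f \<in> Poly_Mapping.keys c'"
    then have "singular_simplex 1 M f"
      using c'(1) by (auto simp: singular_cycle singular_chain_def)
    then show "f \<in> small_simplices 1"
      using c'B [OF f] by (auto simp: small_simplices_def singular_simplex_subtopology)
  qed
  let ?z = "trace_chain_map c'"
  have "net_boundary1 ?z = 0"
    using c'(1) by (simp add: trace_chain_map_boundary singular_cycle cover_chain_def)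
  moreover have "singular_relboundary 1 M {} (c' - realize_chain ?z)"
    using realize_trace [OF small] c'(1) by (simp add: singular_cycle)
  then have "singular_relboundary 1 M {} (c - realize_chain ?z)"
    using singular_relboundary_add c'(2) unfolding homologous_rel_def by fastforce
  ultimately show ?thesis
    using that trace_chain_map_chain [OF small] by blast
qed

text \<open>The trace of a finely subdivided path between base points is an edge path in the net.
  This is the connectedness needed to compute the net cohomology.\<close>

lemma net_connected:
  assumes M: "path_connected_space M" and U: "U \<in> B" "V \<in> B"
  obtains k where "Poly_Mapping.keys k \<subseteq> net_simplices1 B" "net_boundary1 k = frag_of V - frag_of U"
proof -
  let ?x = "base_point U" and ?y = "base_point V"
  have xy: "?x \<in> topspace M" "?y \<in> topspace M"
    using U base_point base_subset by auto
  then obtain g where g: "pathin M g" "g 0 = ?x" "g 1 = ?y"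
    using M by (auto simp: path_connected_space_def)
  let ?f = "frag_of (singular_path g)"
  have f: "singular_chain 1 M ?f"
    using g by (simp add: singular_chain_path)
  obtain m where m: "Poly_Mapping.keys ((singular_subdivision 1 ^^ m) ?f) \<subseteq> small_simplices 1"
    by (rule subdivision_small [OF f])
  let ?t = "trace_chain_map ((singular_subdivision 1 ^^ m) ?f)"
  have "singular_chain 0 M (chain_boundary 1 ?f)"
    using singular_chain_boundary [OF f] by (simp add: One_nat_def)
  from iterated_subdivision_zero [OF this]
  have t: "net_boundary1 ?t = frag_of (cover ?y) - frag_of (cover ?x)"
    by (simp add: chain_boundary_iterated_subdivision [OF f] trace_chain_map_boundary chain_boundary_path cover_chain_def frag_extend_diff g)
  \<comment> \<open>The trace ends at the covers of the base points; the two links lead from there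
    to \<open>V\<close> and \<open>U\<close>.\<close>
  let ?k = "?t + (link V ?y - link U ?x)"
  have "Poly_Mapping.keys ?k \<subseteq> net_simplices1 B"
    using trace_chain_map_chain [OF m] link_chain [OF U(1) base_point [OF U(1)]]
      link_chain [OF U(2) base_point [OF U(2)]] keys_diff [of "link V ?y" "link U ?x"]
      keys_add [of ?t "link V ?y - link U ?x"] by blast
  moreover have "net_boundary1 ?k = frag_of V - frag_of U"
    by (simp add: t link_boundary)
  ultimately show ?thesis
    by (rule that)
qed

end

theorem (in simply_connected_base) net_homology1_iso_homology_group:
  "net_homology1 B \<cong> homology_group 1 M"
proof -
  let ?F = "free_Abelian_group (net_simplices1 B)"
  let ?Z = "kernel ?F (free_Abelian_group B) net_boundary1"
  have Z: "carrier (subgroup_generated ?F ?Z) = ?Z"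
    using subgroup_net_cycles subgroup.carrier_subgroup_generated_subgroup by blast
  have "subgroup_generated ?F ?Z Mod Collect (net_bounds B)
        \<cong> relcycle_group 1 M {} Mod singular_relboundary_set 1 M {}"
  proof (rule FactGroup_iso_FactGroup [OF _ normal_net_bounds normal_subgroup_singular_relboundary_relcycle])
    show "realize_chain \<in> hom (subgroup_generated ?F ?Z) (relcycle_group 1 M {})"
      unfolding hom_def Z
      using realize_chain_singular realize_chain_boundary
      by (auto simp: kernel_def singular_cycle)
  next
    fix z assume "z \<in> carrier (subgroup_generated ?F ?Z)"
    then show "realize_chain z \<in> singular_relboundary_set 1 M {} \<longleftrightarrow> z \<in> Collect (net_bounds B)"
      unfolding Z using realize_chain_injective realize_chain_bounds by (auto simp: kernel_def)
  next
    fix c assume "c \<in> carrier (relcycle_group 1 M {})"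
    then obtain z where z: "Poly_Mapping.keys z \<subseteq> net_simplices1 B" "net_boundary1 z = 0"
      "singular_relboundary 1 M {} (c - realize_chain z)"
      using realize_chain_surjective by auto
    have rz: "realize_chain z \<in> carrier (relcycle_group 1 M {})"
      using z realize_chain_singular realize_chain_boundary by (simp add: singular_cycle)
    have "inv\<^bsub>relcycle_group 1 M {}\<^esub> realize_chain z = - realize_chain z"
      using rz by (intro group.inv_equality) (auto simp: singular_relcycle_minus)
    then show "\<exists>x\<in>carrier (subgroup_generated ?F ?Z).
        c \<otimes>\<^bsub>relcycle_group 1 M {}\<^esub> inv\<^bsub>relcycle_group 1 M {}\<^esub> realize_chain x \<in> singular_relboundary_set 1 M {}"
      unfolding Z using z by (intro bexI [of _ z]) (auto simp: kernel_def)
  qed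
  then show ?thesis
    using nontrivial_relative_homology_group [of 1 M "{}"] by (simp add: net_homology1_alt)
qed

section \<open>Cohomology in degree one\<close>

text \<open>Chains joining one fixed vertex to all others give the homomorphism \<open>K\<close> of
  the retraction: the boundary of an edge has degree zero, so the fixed vertex cancels and d K d =
  d.\<close>

theorem Hom_group_iso_net_cohomology1:
  fixes K :: "'k::order set"
  assumes A: "comm_group A"
    and conn: "\<And>U V. U \<in> K \<Longrightarrow> V \<in> K \<Longrightarrow>
      \<exists>k. Poly_Mapping.keys k \<subseteq> net_simplices1 K \<and> net_boundary1 k = frag_of V - frag_of U"
  shows "Hom_group (net_homology1 K) A \<cong> net_cohomology1 K A"
proof -
  interpret A: comm_group A by fact
  let ?S = "net_simplices1 K"
  let ?C = "free_Abelian_group ?S" and ?D = "free_Abelian_group K"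
  let ?E = "product_group ?S (\<lambda>_. A)"
  \<comment> \<open>For empty \<open>K\<close> this is an unspecified value, and the claims about
    \<open>k\<close> are vacuous.\<close>
  define U0 where "U0 = (SOME U. U \<in> K)"
  have "\<exists>k. Poly_Mapping.keys k \<subseteq> ?S \<and> net_boundary1 k = frag_of U - frag_of U0" if "U \<in> K" for U
    using conn [of U0 U] someI [of "\<lambda>U. U \<in> K" U] that by (simp add: U0_def)
  then obtain k where k: "\<And>U. U \<in> K \<Longrightarrow> Poly_Mapping.keys (k U) \<subseteq> ?S"
    "\<And>U. U \<in> K \<Longrightarrow> net_boundary1 (k U) = frag_of U - frag_of U0"
    by metis
  have faces: "face1_0 b \<in> K" "face1_1 b \<in> K" if "b \<in> ?S" for b
    using that by (auto simp: net_simplices1_def)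
  obtain \<theta> where \<theta>: "\<theta> \<in> iso ?E (Hom_group ?C A)"
    and \<theta>b: "\<And>v b. v \<in> carrier ?E \<Longrightarrow> b \<in> ?S \<Longrightarrow> \<theta> v (frag_of b) = v b"
    using product_group_iso_Hom_group [OF A] by blast
  have \<theta>C: "\<theta> v \<in> hom ?C A" if "v \<in> carrier ?E" for v
  proof -
    have "\<theta> \<in> hom ?E (Hom_group ?C A)"
      using \<theta> by (simp add: iso_def)
    from hom_in_carrier [OF this that] show ?thesis
      by (simp add: carrier_Hom_group)
  qed
  have E: "comm_group ?E"
  proof (rule group.group_comm_groupI)
    show "group ?E"
      by (simp add: A.is_group)
    show "v \<otimes>\<^bsub>?E\<^esub> w = w \<otimes>\<^bsub>?E\<^esub> v" if "v \<in> carrier ?E" "w \<in> carrier ?E" for v w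
      using that by (auto intro!: restrict_ext A.m_comm)
  qed
  show ?thesis
    unfolding net_cohomology1_def net_homology1_alt
  proof (rule Hom_group_homology_iso [OF abelian_free_Abelian_group group_free_Abelian_group A E
        hom_net_boundary1 _ _ subgroup_net_bounds net_bounds_subset_kernel \<theta>])
    show "frag_extend k \<in> hom ?D ?C"
    proof (rule homI)
      fix c assume "c \<in> carrier ?D"
      then show "frag_extend k c \<in> carrier ?C"
        using keys_frag_extend [of k c] k(1) by fastforce
    qed (simp add: frag_extend_add)
  next
    fix c assume "c \<in> carrier ?C"
    then have "Poly_Mapping.keys c \<subseteq> ?S"
      by simp
    then show "net_boundary1 (frag_extend k (net_boundary1 c)) = net_boundary1 c"
      by (induction c rule: frag_induction) (auto simp: frag_extend_diff k faces)
  next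
    fix v assume v: "v \<in> carrier ?E"
    \<comment> \<open>The coboundary of \<open>v\<close> on a 2-simplex is the extension of
      \<open>v\<close> evaluated on its boundary. Hence \<open>v\<close> is a cocycle exactly when
      its extension is trivial on the generators of the boundaries.\<close>
    have *: "\<theta> v (frag_of (face2_0 c) - frag_of (face2_1 c) + frag_of (face2_2 c)) =
             v (face2_0 c) \<otimes>\<^bsub>A\<^esub> inv\<^bsub>A\<^esub> v (face2_1 c) \<otimes>\<^bsub>A\<^esub> v (face2_2 c)"
      if "c \<in> net_simplices2 K" for c
    proof -
      have f: "face2_0 c \<in> ?S" "face2_1 c \<in> ?S" "face2_2 c \<in> ?S"
        using that by (auto simp: net_simplices2_def)
      then have "Poly_Mapping.keys (frag_of (face2_0 c) - frag_of (face2_1 c)) \<subseteq> ?S"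
        using keys_diff [of "frag_of (face2_0 c)" "frag_of (face2_1 c)"] by auto
      then show ?thesis
        using hom_mult [OF \<theta>C [OF v], of "frag_of (face2_0 c) - frag_of (face2_1 c)" "frag_of (face2_2 c)"]
          hom_free_Abelian_group_diff [OF A.is_group \<theta>C [OF v], of "frag_of (face2_0 c)" "frag_of (face2_1 c)"]
          f \<theta>b [OF v] by simp
    qed
    have "v \<in> kernel ?E (product_group (net_simplices2 K) (\<lambda>_. A)) (net_coboundary1 K A) \<longleftrightarrow>
          (\<forall>c\<in>net_simplices2 K. v (face2_0 c) \<otimes>\<^bsub>A\<^esub> inv\<^bsub>A\<^esub> v (face2_1 c) \<otimes>\<^bsub>A\<^esub> v (face2_2 c) = \<one>\<^bsub>A\<^esub>)"
      using v by (auto simp: kernel_def net_coboundary1_def fun_eq_iff restrict_def)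
    also have "\<dots> \<longleftrightarrow> (\<forall>n\<in>Collect (net_bounds K). \<theta> v n = \<one>\<^bsub>A\<^esub>)"
    proof
      assume L: "\<forall>c\<in>net_simplices2 K. v (face2_0 c) \<otimes>\<^bsub>A\<^esub> inv\<^bsub>A\<^esub> v (face2_1 c) \<otimes>\<^bsub>A\<^esub> v (face2_2 c) = \<one>\<^bsub>A\<^esub>"
      have "Poly_Mapping.keys n \<subseteq> ?S \<and> \<theta> v n = \<one>\<^bsub>A\<^esub>" if "net_bounds K n" for n
        using that
      proof (induction rule: net_bounds_induct)
        case zero
        then show ?case
          using hom_one [OF \<theta>C [OF v] group_free_Abelian_group A.is_group] by simp
      next
        case (diff x y)
        then show ?case
          using hom_free_Abelian_group_diff [OF A.is_group \<theta>C [OF v], of x y] keys_diff [of x y] by auto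
      next
        case (simplex c)
        have "net_bounds K (net_boundary2 (frag_of c))"
          using simplex unfolding net_bounds_def by (intro imageI) simp
        then show ?case
          using * [OF simplex] L simplex net_bounds_imp_chain by auto
      qed
      then show "\<forall>n\<in>Collect (net_bounds K). \<theta> v n = \<one>\<^bsub>A\<^esub>"
        by blast
    next
      assume R: "\<forall>n\<in>Collect (net_bounds K). \<theta> v n = \<one>\<^bsub>A\<^esub>"
      show "\<forall>c\<in>net_simplices2 K. v (face2_0 c) \<otimes>\<^bsub>A\<^esub> inv\<^bsub>A\<^esub> v (face2_1 c) \<otimes>\<^bsub>A\<^esub> v (face2_2 c) = \<one>\<^bsub>A\<^esub>"
      proof
        fix c assume c: "c \<in> net_simplices2 K"
        then have "net_bounds K (net_boundary2 (frag_of c))"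
          unfolding net_bounds_def by (intro imageI) simp
        then show "v (face2_0 c) \<otimes>\<^bsub>A\<^esub> inv\<^bsub>A\<^esub> v (face2_1 c) \<otimes>\<^bsub>A\<^esub> v (face2_2 c) = \<one>\<^bsub>A\<^esub>"
          using R * [OF c] by simp
      qed
    qed
    finally show "v \<in> kernel ?E (product_group (net_simplices2 K) (\<lambda>_. A)) (net_coboundary1 K A) \<longleftrightarrow>
          (\<forall>n\<in>Collect (net_bounds K). \<theta> v n = \<one>\<^bsub>A\<^esub>)" .
  next
    show "kernel ?E (product_group (net_simplices2 K) (\<lambda>_. A)) (net_coboundary1 K A) \<subseteq> carrier ?E"
      by (auto simp: kernel_def)
  next
    have *: "g (net_boundary1 (frag_of b)) = g (frag_of (face1_0 b)) \<otimes>\<^bsub>A\<^esub> inv\<^bsub>A\<^esub> g (frag_of (face1_1 b))"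
      if "g \<in> hom ?D A" "b \<in> ?S" for g b
      using hom_free_Abelian_group_diff [OF A.is_group that(1)] faces [OF that(2)] by simp
    fix v assume v: "v \<in> carrier ?E"
    show "v \<in> net_coboundary0 K A ` carrier (product_group K (\<lambda>_. A)) \<longleftrightarrow>
          (\<exists>g\<in>hom ?D A. \<forall>c\<in>carrier ?C. \<theta> v c = g (net_boundary1 c))"
    proof
      assume "v \<in> net_coboundary0 K A ` carrier (product_group K (\<lambda>_. A))"
      then obtain w where w: "w \<in> carrier (product_group K (\<lambda>_. A))" "v = net_coboundary0 K A w"
        by blast
      then have "w ` K \<subseteq> carrier A"
        by auto
      then obtain g where g: "g \<in> hom ?D A" "\<And>U. U \<in> K \<Longrightarrow> g (frag_of U) = w U"
        using A.free_Abelian_group_universal by blast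
      have "\<theta> v c = (g \<circ> net_boundary1) c" if c: "Poly_Mapping.keys c \<subseteq> ?S" for c
      proof (rule hom_free_Abelian_group_eq [OF A.is_group \<theta>C [OF v] hom_compose [OF hom_net_boundary1 g(1)] _ c])
        fix b assume b: "b \<in> ?S"
        then show "\<theta> v (frag_of b) = (g \<circ> net_boundary1) (frag_of b)"
          using * [OF g(1) b] g(2) faces [OF b] \<theta>b [OF v b] w(2)
          by (simp del: net_boundary1_simps add: net_coboundary0_def)
      qed
      then show "\<exists>g\<in>hom ?D A. \<forall>c\<in>carrier ?C. \<theta> v c = g (net_boundary1 c)"
        using g(1) by auto
    next
      assume "\<exists>g\<in>hom ?D A. \<forall>c\<in>carrier ?C. \<theta> v c = g (net_boundary1 c)"
      then obtain g where g: "g \<in> hom ?D A" "\<And>c. c \<in> carrier ?C \<Longrightarrow> \<theta> v c = g (net_boundary1 c)"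
        by blast
      let ?w = "\<lambda>U\<in>K. g (frag_of U)"
      have "?w \<in> carrier (product_group K (\<lambda>_. A))"
        using g(1) by (auto intro: hom_in_carrier)
      moreover have "v = net_coboundary0 K A ?w"
      proof
        fix b show "v b = net_coboundary0 K A ?w b"
        proof (cases "b \<in> ?S")
          case True
          then show ?thesis
            using \<theta>b [OF v True] g(2) [of "frag_of b"] * [OF g(1) True] faces [OF True]
            by (simp del: net_boundary1_simps add: net_coboundary0_def)
        next
          case False
          then show ?thesis
            using v by (auto simp: net_coboundary0_def PiE_def extensional_def)
        qed
      qed
      ultimately show "v \<in> net_coboundary0 K A ` carrier (product_group K (\<lambda>_. A))"
        by blast
    qed
  next
    show "net_coboundary0 K A ` carrier (product_group K (\<lambda>_. A)) \<subseteq> carrier ?E"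
    proof (clarsimp simp: net_coboundary0_def)
      fix w b assume w: "w \<in> K \<rightarrow>\<^sub>E carrier A" and b: "b \<in> ?S"
      show "w (face1_0 b) \<otimes>\<^bsub>A\<^esub> inv\<^bsub>A\<^esub> w (face1_1 b) \<in> carrier A"
        using PiE_mem [OF w] faces [OF b] by simp
    qed
  qed
qed

text \<open>Here cochains already are homomorphisms on chains, so \<theta> is the identity. The
  chosen chains from a fixed vertex are single paths from a base point \<open>x0\<close>.\<close>

theorem Hom_group_iso_singular_cohomology1:
  fixes X :: "'x topology"
  assumes A: "comm_group A" and X: "path_connected_space X"
  shows "Hom_group (homology_group 1 X) A \<cong> singular_cohomology_group 1 X A"
proof -
  interpret A: comm_group A by fact
  let ?C = "chain_group 1 X" and ?D = "chain_group 0 X" and ?d = "chain_boundary 1"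
  define x0 where "x0 = (SOME x. x \<in> topspace X)"
  have "\<exists>k. pathin X k \<and> k 0 = x0 \<and> k 1 = p" if "p \<in> topspace X" for p
    using X that someI [of "\<lambda>x. x \<in> topspace X" p] by (simp add: path_connected_space_def x0_def)
  then obtain k where k: "\<And>p. p \<in> topspace X \<Longrightarrow> pathin X (k p)"
    "\<And>p. p \<in> topspace X \<Longrightarrow> k p 0 = x0" "\<And>p. p \<in> topspace X \<Longrightarrow> k p 1 = p"
    by metis
  define K where "K = frag_extend (\<lambda>s. frag_of (singular_path (k (simplex_start s))))"
  have d: "?d \<in> hom ?C ?D"
  proof (rule homI)
    fix c assume "c \<in> carrier ?C"
    then show "?d c \<in> carrier ?D"
      using singular_chain_boundary [of 1 X c] by simp
  qed (simp add: chain_boundary_add)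
  have ker: "kernel ?C ?D ?d = singular_relcycle_set 1 X {}"
    by (auto simp: kernel_def singular_cycle)
  have E: "comm_group (Hom_group ?C A)"
    by (intro comm_group_Hom_group A) simp
  have "Hom_group (subgroup_generated ?C (kernel ?C ?D ?d) Mod singular_relboundary_set 1 X {}) A
      \<cong> subgroup_generated (Hom_group ?C A)
          (kernel (Hom_group ?C A) (Hom_group (chain_group 2 X) A) (singular_coboundary 2 X))
        Mod (singular_coboundary 1 X ` carrier (Hom_group ?D A))"
  proof (rule Hom_group_homology_iso [OF abelian_chain_group group_chain_group A E d _ _
        subgroup_singular_relboundary _ iso_set_refl])
    show "K \<in> hom ?D ?C"
    proof (rule homI)
      fix c assume "c \<in> carrier ?D"
      then have c: "Poly_Mapping.keys c \<subseteq> singular_simplex_set 0 X"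
        by (simp add: singular_chain_def)
      show "K c \<in> carrier ?C"
        unfolding K_def carrier_chain_group mem_Collect_eq
      proof (rule singular_chain_extend)
        fix s assume "s \<in> Poly_Mapping.keys c"
        then show "singular_chain 1 X (frag_of (singular_path (k (simplex_start s))))"
          using c k(1) singular_chain_path by (fastforce simp: singular_simplex_0_iff)
      qed
    qed (simp add: K_def frag_extend_add)
  next
    fix c assume "c \<in> carrier ?C"
    then have "Poly_Mapping.keys c \<subseteq> singular_simplex_set 1 X"
      by (simp add: singular_chain_def)
    then show "?d (K (?d c)) = ?d c"
    proof (induction c rule: frag_induction)
      case (one f)
      then show ?case
        using simplex_ends_in_topspace [of X f]
        by (simp add: K_def chain_boundary_1 frag_extend_diff chain_boundary_diff k)
    qed (auto simp: K_def frag_extend_diff chain_boundary_diff)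
  next
    show "singular_relboundary_set 1 X {} \<subseteq> kernel ?C ?D ?d"
      unfolding ker using singular_relboundary_imp_relcycle by blast
  next
    fix f assume f: "f \<in> carrier (Hom_group ?C A)"
    show "f \<in> kernel (Hom_group ?C A) (Hom_group (chain_group 2 X) A) (singular_coboundary 2 X)
          \<longleftrightarrow> (\<forall>n\<in>singular_relboundary_set 1 X {}. f n = \<one>\<^bsub>A\<^esub>)"
      using f by (auto simp: kernel_def singular_coboundary_def one_Hom_group singular_boundary
          fun_eq_iff restrict_def numeral_2_eq_2 One_nat_def)
    show "f \<in> singular_coboundary 1 X ` carrier (Hom_group ?D A)
          \<longleftrightarrow> (\<exists>g\<in>hom ?D A. \<forall>c\<in>carrier ?C. f c = g (?d c))"
    proof
      assume "f \<in> singular_coboundary 1 X ` carrier (Hom_group ?D A)"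
      then show "\<exists>g\<in>hom ?D A. \<forall>c\<in>carrier ?C. f c = g (?d c)"
        by (auto simp: singular_coboundary_def carrier_Hom_group)
    next
      assume "\<exists>g\<in>hom ?D A. \<forall>c\<in>carrier ?C. f c = g (?d c)"
      then obtain g where g: "g \<in> hom ?D A" "\<And>c. c \<in> carrier ?C \<Longrightarrow> f c = g (?d c)"
        by blast
      have "f = singular_coboundary 1 X (restrict g (carrier ?D))"
      proof (rule extensionalityI [where A = "carrier ?C"])
        fix c assume "c \<in> carrier ?C"
        then show "f c = singular_coboundary 1 X (restrict g (carrier ?D)) c"
          using g(2) [of c] hom_in_carrier [OF d, of c] by (simp add: singular_coboundary_def)
      qed (use f in \<open>auto simp: carrier_Hom_group singular_coboundary_def\<close>)
      then show "f \<in> singular_coboundary 1 X ` carrier (Hom_group ?D A)"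
        using restrict_in_Hom_group [OF _ g(1)] by simp
    qed
  next
    show "kernel (Hom_group ?C A) (Hom_group (chain_group 2 X) A) (singular_coboundary 2 X)
          \<subseteq> carrier (Hom_group ?C A)"
      by (auto simp: kernel_def)
    show "singular_coboundary 1 X ` carrier (Hom_group ?D A) \<subseteq> carrier (Hom_group ?C A)"
    proof
      fix f assume "f \<in> singular_coboundary 1 X ` carrier (Hom_group ?D A)"
      then obtain g where g: "g \<in> hom ?D A" "f = restrict (g \<circ> ?d) (carrier ?C)"
        by (auto simp: carrier_Hom_group singular_coboundary_def comp_def)
      then show "f \<in> carrier (Hom_group ?C A)"
        using restrict_in_Hom_group [OF _ hom_compose [OF d g(1)]] by simp
    qed
  qed
  moreover have "homology_group 1 X
      = subgroup_generated ?C (kernel ?C ?D ?d) Mod singular_relboundary_set 1 X {}"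
    using nontrivial_relative_homology_group [of 1 X "{}"] by (simp add: ker relcycle_group_def)
  ultimately show ?thesis
    by (simp add: singular_cohomology_group_def numeral_2_eq_2 One_nat_def)
qed

theorem theorem3p8:
  fixes M :: "'m topology" and B :: "'m set set" and A :: "('a, 'b) monoid_scheme"
  assumes "path_connected_space M" and "Hausdorff_space M"
    and "locally_path_connected_space M" and "locally_simply_connected_space M"
    and base: "openin M = arbitrary union_of (\<lambda>U. U \<in> B)"
    and "\<And>U. U \<in> B \<Longrightarrow> U \<noteq> {} \<and> path_connectedin M U \<and> simply_connectedin M U"
  shows "homology_group 1 M \<cong> net_homology1 B \<and>
         (comm_group A \<longrightarrow>
            net_cohomology1 B A \<cong> Hom_group (homology_group 1 M) A \<and>
            net_cohomology1 B A \<cong> singular_cohomology_group 1 M A)"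
proof -
  interpret simply_connected_base M B
  proof
    show "openin M = arbitrary union_of (\<lambda>U. U \<in> B)"
      by (rule base)
    show "U \<noteq> {}" "simply_connectedin M U" if "U \<in> B" for U
      using assms(6) [OF that] by auto
  qed
  have homology: "homology_group 1 M \<cong> net_homology1 B"
    using net_homology1_iso_homology_group group.iso_sym group_net_homology1 by blast
  have "net_cohomology1 B A \<cong> Hom_group (homology_group 1 M) A"
    "net_cohomology1 B A \<cong> singular_cohomology_group 1 M A" if A: "comm_group A"
  proof -
    have gH: "group (homology_group 1 M)"
      by simp
    have "Hom_group (homology_group 1 M) A \<cong> Hom_group (net_homology1 B) A"
      by (intro Hom_group_cong_iso group_net_homology1 gH homology)
    also have "\<dots> \<cong> net_cohomology1 B A"
      using net_connected [OF assms(1)] by (intro Hom_group_iso_net_cohomology1 A) metis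
    finally show 1: "net_cohomology1 B A \<cong> Hom_group (homology_group 1 M) A"
      using comm_group_Hom_group [OF gH A] by (simp add: comm_group_def group.iso_sym)
    \<comment> \<open>No map between net and singular cochains is constructed: both cohomology
      groups are identified with the same group of homomorphisms.\<close>
    show "net_cohomology1 B A \<cong> singular_cohomology_group 1 M A"
      using 1 Hom_group_iso_singular_cohomology1 [OF A assms(1)] by (rule iso_trans)
  qed
  with homology show ?thesis
    by blast
qed

end
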